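(* There is a partial feedback computable function $G$ such that for any $X,Y\in{}^{\omega}2$, and for all $\gamma=\langle e^0,m^0,X\rangle$ and $\delta=\langle e^1,m^1,Y\rangle$ (with $e^0,m^0,e^1,m^1\in\omega$): (i) if $\rho(\gamma)<\omega_1$ and $\rho(\gamma)\le\rho(\delta)$, then $G(\gamma,\delta)\simeq 0$; (ii) if $\rho(\delta)<\omega_1$ and $\rho(\delta)<\rho(\gamma)$, then $G(\gamma,\delta)\simeq 1$.
   Context: **Feedback computation.** Programs are ordinary oracle Turing machine programs (with oracle $X$), indexed by $e\in\omega$ in a standard way, with an additional instruction allowing the machine at any stage to issue a query $Q^X(e',m')$, with $e',m'$ integers computed by the machine, asking whether the feedback computation $\langle e'\rangle^X(m')$ converges or diverges, and receiving (in one step) an answer in $\{\downarrow,\uparrow\}$. Finite sequences of integers are coded by integers. Formally, for a partial function $C$ let $I(C)$ be the set of pairs $\langle\langle e,m,X\rangle,\langle j,k\rangle\rangle$ such that program $e$, run on input $m$ with oracle $X$, makes only queries $Q^X(e',m')$ for which $C(\langle e',m',X\rangle)=\langle j',k'\rangle$ is defined, each such query being answered by $j'$, and either this run halts with output $k\in\omega$ and $j=\,\downarrow$, or it runs forever and $j=\,\uparrow$, $k=\omega$. Set $I_0=\emptyset$ at the start of the iteration in the sense $I_{<\alpha}=\bigcup_{\beta<\alpha}I_\beta$ and $I_\alpha=I(I_{<\alpha})$, so that the computations of rank $0$ (defined next) are exactly those making no queries; let $I_\infty$ be the resulting least fixed point. Write $\langle e\rangle^X(m)\downarrow k$, or $\langle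 e\rangle^X(m)\simeq k$, iff $I_\infty(\langle e,m,X\rangle)=\langle\downarrow,k\rangle$. **Rank.** $\rho(e,m,X)$ is the least $\alpha$ such that $\langle\langle e,m,X\rangle,\langle j,k\rangle\rangle\in I_\alpha$ for some $\langle j,k\rangle$; if there is no such $\alpha$, i.e. $\langle e,m,X\rangle\notin\mathrm{dom}(I_\infty)$, set $\rho(e,m,X)=\omega_1$. (All defined ranks are countable ordinals.) **Partial feedback computable function of $\gamma,\delta$.** This means that there is a single index $g\in\omega$ such that for all arguments $G(\langle e^0,m^0,X\rangle,\langle e^1,m^1,Y\rangle)\simeq\langle g\rangle^{X\oplus Y}(e^0,m^0,e^1,m^1)$, i.e. the integers are the inputs and $X,Y$ are available as oracles ($X\oplus Y$ is the recursive join). $G(\gamma,\delta)\simeq i$ means that this computation converges with output $i$. *)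

theory Defs
  imports
    Complex_Main
    "HOL-Library.Nat_Bijection"
    "HOL-Library.Countable_Set"
begin

section \<open>Machines\<close>

text \<open>
  Programs are those of ordinary Turing machines with one-way infinite tapes numbered
  \<open>0, 1, 2, \<dots>\<close>, each program using finitely many of them, extended by instructions for oracle
  queries and feedback queries. A program is the list of the instructions attached to its
  states \<open>0, \<dots>, length P - 1\<close>, with \<open>0\<close> the initial state. Tape symbols are
  natural numbers, \<open>0\<close> being the blank. The instruction \<open>Act i \<delta>\<close> is a finite
  transition table for tape \<open>i\<close>: the entry \<open>(s, s', d, q)\<close> means ``scanning \<open>s\<close>, write
  \<open>s'\<close>, move as \<open>d\<close> says and enter state \<open>q\<close>''.
  In \<open>Oracle_Query i q q'\<close> and \<open>Feedback_Query i j q q'\<close> the queried numbers are read off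
  tapes \<open>i\<close> and \<open>j\<close>; the next state is \<open>q\<close> for the answers yes and ``converges'', and \<open>q'\<close>
  for no and ``diverges''.
\<close>

datatype move = Left | Stay | Right

datatype instr =
    Act nat "(nat \<times> nat \<times> move \<times> nat) list"
  | Oracle_Query nat nat nat
  | Feedback_Query nat nat nat nat

type_synonym program = "instr list"

fun decode_move :: "nat \<Rightarrow> move" where
  "decode_move n = (if n mod 3 = 0 then Left else if n mod 3 = 1 then Stay else Right)"

fun decode_entry :: "nat \<Rightarrow> nat \<times> nat \<times> move \<times> nat" where
  "decode_entry n =
    (let (s, n1) = prod_decode n; (s', n2) = prod_decode n1; (d, q) = prod_decode n2
     in (s, s', decode_move d, q))"

fun decode_instr :: "nat \<Rightarrow> instr" where
  "decode_instr n =
    (let (i, n1) = prod_decode (n div 3); (j, n2) = prod_decode n1; (q, q') = prod_decode n2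
     in if n mod 3 = 0 then Act i (map decode_entry (list_decode n1))
        else if n mod 3 = 1 then Oracle_Query i j n2
        else Feedback_Query i j q q')"

definition program_of :: "nat \<Rightarrow> program" where
  "program_of e = map decode_instr (list_decode e)"

record config =
  state :: nat
  cells :: "nat \<Rightarrow> nat \<Rightarrow> nat"
  head :: "nat \<Rightarrow> nat"

definition scanned :: "config \<Rightarrow> nat \<Rightarrow> nat" where
  "scanned c i = cells c i (head c i)"

text \<open>
  A number is represented in unary, by the length of the initial block of symbols \<open>1\<close>. The
  minimum exists since only finitely many cells are ever non-blank.
\<close>

definition tape_value :: "config \<Rightarrow> nat \<Rightarrow> nat" where
  "tape_value c i = (LEAST n. cells c i n \<noteq> 1)"

definition initial_config :: "nat \<Rightarrow> config" where
  "initial_config m =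
    \<lparr>state = 0, cells = (\<lambda>i n. if i = 0 \<and> n < m then 1 else 0), head = (\<lambda>_. 0)\<rparr>"

fun move_head :: "move \<Rightarrow> nat \<Rightarrow> nat" where
  "move_head Left n = n - 1"  \<comment> \<open>at the left end of the tape the head stays put\<close>
| "move_head Stay n = n"
| "move_head Right n = Suc n"

section \<open>Feedback computation\<close>

type_synonym oracle_set = "nat \<Rightarrow> bool"

type_synonym comp = "nat \<times> nat \<times> oracle_set"

text \<open>
  \<open>Conv k\<close> is the pair of \<open>\<down>\<close> and \<open>k\<close>, and \<open>Div\<close> is the pair of \<open>\<up>\<close> and \<open>\<omega>\<close>. Partial functions
  \<open>C\<close> from computations to outcomes are given by their graphs.
\<close>

datatype outcome = Conv nat | Div

inductive step :: "(comp \<times> outcome) set \<Rightarrow> program \<Rightarrow> oracle_set \<Rightarrow> config \<Rightarrow> config \<Rightarrow> bool"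
  for C P X where
  act: "\<lbrakk>state c < length P; P ! state c = Act i \<delta>; map_of \<delta> (scanned c i) = Some (s, d, q)\<rbrakk>
    \<Longrightarrow> step C P X c
          \<lparr>state = q,
           cells = (cells c)(i := (cells c i)(head c i := s)),
           head = (head c)(i := move_head d (head c i))\<rparr>"
| oracle_query: "\<lbrakk>state c < length P; P ! state c = Oracle_Query i q q'\<rbrakk>
    \<Longrightarrow> step C P X c (c\<lparr>state := (if X (tape_value c i) then q else q')\<rparr>)"
| query_conv: "\<lbrakk>state c < length P; P ! state c = Feedback_Query i j q q';
      ((tape_value c i, tape_value c j, X), Conv k) \<in> C\<rbrakk>
    \<Longrightarrow> step C P X c (c\<lparr>state := q\<rparr>)"
| query_div: "\<lbrakk>state c < length P; P ! state c = Feedback_Query i j q q';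
      ((tape_value c i, tape_value c j, X), Div) \<in> C\<rbrakk>
    \<Longrightarrow> step C P X c (c\<lparr>state := q'\<rparr>)"

text \<open>
  A machine waiting for the answer to a query on which \<open>C\<close> is undefined has no next
  configuration, but it is not halted.
\<close>

definition halted :: "program \<Rightarrow> config \<Rightarrow> bool" where
  "halted P c \<longleftrightarrow> length P \<le> state c \<or>
    (\<exists>i \<delta>. P ! state c = Act i \<delta> \<and> map_of \<delta> (scanned c i) = None)"

definition I_op :: "(comp \<times> outcome) set \<Rightarrow> (comp \<times> outcome) set" where
  "I_op C =
    {((e, m, X), Conv k) | e m X k.
      \<exists>c. (step C (program_of e) X)\<^sup>*\<^sup>* (initial_config m) c \<and> halted (program_of e) c \<and>
        tape_value c 0 = k} \<union>
    {((e, m, X), Div) | e m X.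
      \<exists>f. f 0 = initial_config m \<and> (\<forall>n. step C (program_of e) X (f n) (f (Suc n)))}"

definition I_infty :: "(comp \<times> outcome) set" where
  "I_infty = lfp I_op"

definition feedback_conv :: "nat \<Rightarrow> oracle_set \<Rightarrow> nat \<Rightarrow> nat \<Rightarrow> bool" where
  "feedback_conv e X m k \<longleftrightarrow> ((e, m, X), Conv k) \<in> I_infty"

section \<open>Countable ordinals and rank\<close>

text \<open>
  The cardinal successor of \<open>\<omega>\<close> is a well-order of type \<open>\<omega>\<^sub>1\<close>; its elements represent the
  ordinals below \<open>\<omega>\<^sub>1\<close>.
\<close>

typedef countable_ordinal = "Field (cardSuc natLeq)"
  using cardSuc_finite[OF natLeq_Card_order] Field_natLeq
  by (metis finite.emptyI infinite_UNIV_nat all_not_in_conv)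

lemma Well_order_cardSuc_natLeq: "Well_order (cardSuc natLeq)"
  using cardSuc_Card_order[OF natLeq_Card_order] card_order_on_well_order_on by blast

instantiation countable_ordinal :: wellorder
begin

definition less_eq_countable_ordinal :: "countable_ordinal \<Rightarrow> countable_ordinal \<Rightarrow> bool" where
  "\<alpha> \<le> \<beta> \<longleftrightarrow> (Rep_countable_ordinal \<alpha>, Rep_countable_ordinal \<beta>) \<in> cardSuc natLeq"

definition less_countable_ordinal :: "countable_ordinal \<Rightarrow> countable_ordinal \<Rightarrow> bool" where
  "\<alpha> < \<beta> \<longleftrightarrow> \<alpha> \<le> \<beta> \<and> \<not> \<beta> \<le> (\<alpha> :: countable_ordinal)"

instance
proof
  have W: "Refl (cardSuc natLeq)" "trans (cardSuc natLeq)" "antisym (cardSuc natLeq)"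
      "Total (cardSuc natLeq)" "wf (cardSuc natLeq - Id)"
    using Well_order_cardSuc_natLeq unfolding order_on_defs by auto
  fix x y z :: countable_ordinal
  note R = Rep_countable_ordinal[of x] Rep_countable_ordinal[of y] Rep_countable_ordinal[of z]
  show "x < y \<longleftrightarrow> x \<le> y \<and> \<not> y \<le> x"
    by (rule less_countable_ordinal_def)
  show refl: "x \<le> x"
    using W(1) R by (auto simp: less_eq_countable_ordinal_def refl_on_def)
  show "x \<le> y \<Longrightarrow> y \<le> z \<Longrightarrow> x \<le> z"
    using W(2) unfolding less_eq_countable_ordinal_def by (rule transD)
  show "x \<le> y \<Longrightarrow> y \<le> x \<Longrightarrow> x = y"
    using W(3) by (metis less_eq_countable_ordinal_def antisymD Rep_countable_ordinal_inject)
  show "x \<le> y \<or> y \<le> x"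
    using W(4) R refl unfolding less_eq_countable_ordinal_def total_on_def
    by (metis Rep_countable_ordinal_inject)
next
  fix P :: "countable_ordinal \<Rightarrow> bool" and a
  assume step: "\<And>x. (\<And>y. y < x \<Longrightarrow> P y) \<Longrightarrow> P x"
  have "wf (inv_image (cardSuc natLeq - Id) Rep_countable_ordinal)"
    using Well_order_cardSuc_natLeq unfolding well_order_on_def by (intro wf_inv_image) auto
  moreover have "{(x, y). x < y} \<subseteq> inv_image (cardSuc natLeq - Id) Rep_countable_ordinal"
    by (auto simp: less_countable_ordinal_def less_eq_countable_ordinal_def in_inv_image)
  ultimately have "wf {(x, y :: countable_ordinal). x < y}"
    by (rule wf_subset)
  then show "P a"
    using step by (rule wf_induct_rule) auto
qed

end

function I_stage :: "countable_ordinal \<Rightarrow> (comp \<times> outcome) set" where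
  "I_stage \<alpha> = I_op (\<Union>\<beta>\<in>{\<beta>. \<beta> < \<alpha>}. I_stage \<beta>)"
  by pat_completeness auto
termination
  by (relation "{(\<beta>, \<alpha>). \<beta> < \<alpha>}") (auto simp: wf)

declare I_stage.simps [simp del]

datatype ordinal_le_omega1 = Countable countable_ordinal | Omega1 (\<open>\<omega>\<^sub>1\<close>)

instantiation ordinal_le_omega1 :: linorder
begin

fun less_eq_ordinal_le_omega1 :: "ordinal_le_omega1 \<Rightarrow> ordinal_le_omega1 \<Rightarrow> bool" where
  "Countable \<alpha> \<le> Countable \<beta> \<longleftrightarrow> \<alpha> \<le> \<beta>"
| "Countable \<alpha> \<le> \<omega>\<^sub>1 \<longleftrightarrow> True"
| "\<omega>\<^sub>1 \<le> Countable \<beta> \<longleftrightarrow> False"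
| "\<omega>\<^sub>1 \<le> \<omega>\<^sub>1 \<longleftrightarrow> True"

definition less_ordinal_le_omega1 :: "ordinal_le_omega1 \<Rightarrow> ordinal_le_omega1 \<Rightarrow> bool" where
  "x < y \<longleftrightarrow> x \<le> y \<and> \<not> y \<le> (x :: ordinal_le_omega1)"

instance
proof
  fix x y z :: ordinal_le_omega1
  show "x < y \<longleftrightarrow> x \<le> y \<and> \<not> y \<le> x"
    by (rule less_ordinal_le_omega1_def)
  show "x \<le> x"
    by (cases x) auto
  show "x \<le> y \<Longrightarrow> y \<le> z \<Longrightarrow> x \<le> z"
    by (cases x; cases y; cases z) auto
  show "x \<le> y \<Longrightarrow> y \<le> x \<Longrightarrow> x = y"
    by (cases x; cases y) auto
  show "x \<le> y \<or> y \<le> x"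
    by (cases x; cases y) auto
qed

end

text \<open>
  Only countable stages are considered; by \<open>I_infty_eq_Union_I_stage\<close> below the iteration is
  complete at \<open>\<omega>\<^sub>1\<close>, so that this is the rank with respect to the iteration along all ordinals.
\<close>

definition rank :: "comp \<Rightarrow> ordinal_le_omega1" (\<open>\<rho>\<close>) where
  "\<rho> \<gamma> = (if \<exists>\<alpha> r. (\<gamma>, r) \<in> I_stage \<alpha>
           then Countable (LEAST \<alpha>. \<exists>r. (\<gamma>, r) \<in> I_stage \<alpha>) else \<omega>\<^sub>1)"

section \<open>Partial feedback computable functions of two computations\<close>

definition join :: "oracle_set \<Rightarrow> oracle_set \<Rightarrow> oracle_set" (infixr \<open>\<oplus>\<close> 65) where
  "(X \<oplus> Y) n = (if even n then X (n div 2) else Y (n div 2))"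

definition partial_feedback_computable :: "(comp \<Rightarrow> comp \<Rightarrow> nat option) \<Rightarrow> bool" where
  "partial_feedback_computable G \<longleftrightarrow>
    (\<exists>g. \<forall>e0 m0 X e1 m1 Y i.
      G (e0, m0, X) (e1, m1, Y) = Some i \<longleftrightarrow>
      feedback_conv g (X \<oplus> Y) (list_encode [e0, m0, e1, m1]) i)"

section \<open>Basic properties\<close>

lemma surj_program_of: "surj program_of"
proof -
  have move: "\<exists>n. decode_move n = d" for d
    by (cases d) (auto intro: exI[of _ 0] exI[of _ 1] exI[of _ 2])
  have entry: "\<exists>n. decode_entry n = t" for t
  proof -
    obtain s s' d q where t: "t = (s, s', d, q)" by (cases t)
    obtain n where "decode_move n = d" using move by blast
    then have "decode_entry (prod_encode (s, prod_encode (s', prod_encode (n, q)))) = t"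
      by (simp add: t del: decode_move.simps)
    then show ?thesis by blast
  qed
  have list: "\<exists>n. map f (list_decode n) = xs" if "surj f" for f :: "nat \<Rightarrow> 'a" and xs
  proof -
    have "map f (map (inv f) xs) = xs"
      using that by (simp add: comp_def surj_f_inv_f)
    then show ?thesis by (metis list_encode_inverse)
  qed
  have div3: "Suc (3 * k) div 3 = k" "Suc (Suc (3 * k)) div 3 = k" "Suc (Suc (3 * k)) mod 3 = 2"
    for k :: nat
    by presburger+
  have instr: "\<exists>n. decode_instr n = a" for a
  proof (cases a)
    case (Act i \<delta>)
    obtain k where k: "map decode_entry (list_decode k) = \<delta>"
      using list[of decode_entry] entry by (metis surj_def)
    have "decode_instr (3 * prod_encode (i, k)) = a"
      using k Act by (simp add: Let_def case_prod_beta del: decode_entry.simps)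
    then show ?thesis by blast
  next
    case (Oracle_Query i q q')
    have "decode_instr (3 * prod_encode (i, prod_encode (q, q')) + 1) = a"
      using Oracle_Query by (simp add: Let_def case_prod_beta div3)
    then show ?thesis by blast
  next
    case (Feedback_Query i j q q')
    have "decode_instr (3 * prod_encode (i, prod_encode (j, prod_encode (q, q'))) + 2) = a"
      using Feedback_Query by (simp add: Let_def case_prod_beta div3)
    then show ?thesis by blast
  qed
  show ?thesis
    unfolding program_of_def surj_def using list[of decode_instr] instr by (metis surj_def)
qed

lemma I_op_cases [consumes 1, case_names converges diverges]:
  assumes "((e, m, X), r) \<in> I_op C"
  obtains c where "r = Conv (tape_value c 0)"
      "(step C (program_of e) X)\<^sup>*\<^sup>* (initial_config m) c" "halted (program_of e) c"
    | f where "r = Div" "f 0 = initial_config m"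
      "\<And>n. step C (program_of e) X (f n) (f (Suc n))"
  using assms by (auto simp: I_op_def)

lemma I_op_converges:
  "(step C (program_of e) X)\<^sup>*\<^sup>* (initial_config m) c \<Longrightarrow> halted (program_of e) c
    \<Longrightarrow> ((e, m, X), Conv (tape_value c 0)) \<in> I_op C"
  by (auto simp: I_op_def)

lemma I_op_diverges:
  "f 0 = initial_config m \<Longrightarrow> (\<And>n. step C (program_of e) X (f n) (f (Suc n)))
    \<Longrightarrow> ((e, m, X), Div) \<in> I_op C"
  by (auto simp: I_op_def)

lemma step_mono: "C \<subseteq> D \<Longrightarrow> step C P X c c' \<Longrightarrow> step D P X c c'"
  by (erule step.cases) (simp_all only:, (blast intro: step.intros)+)

lemma rtranclp_step_mono: "C \<subseteq> D \<Longrightarrow> (step C P X)\<^sup>*\<^sup>* c c' \<Longrightarrow> (step D P X)\<^sup>*\<^sup>* c c'"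
  by (erule rtranclp_mono[THEN predicate2D, rotated]) (auto intro: step_mono)

lemma mono_I: "mono I_op"
proof (rule monoI, rule subrelI, clarify)
  fix C D e m X r
  assume CD: "C \<subseteq> D" and "((e, m, X), r) \<in> I_op C"
  from this(2) show "((e, m, X), r) \<in> I_op D"
  proof (cases rule: I_op_cases)
    case (converges c)
    have "(step D (program_of e) X)\<^sup>*\<^sup>* (initial_config m) c"
      using CD converges(2) by (rule rtranclp_step_mono)
    then show ?thesis using converges(1,3) by (simp add: I_op_converges)
  next
    case (diverges f)
    have "((e, m, X), Div) \<in> I_op D"
      by (rule I_op_diverges[of f, OF diverges(2)]) (rule step_mono[OF CD diverges(3)])
    then show ?thesis using diverges(1) by simp
  qed
qed

lemma I_stage_subset: "\<alpha> \<le> \<beta> \<Longrightarrow> I_stage \<alpha> \<subseteq> I_stage \<beta>"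
  unfolding I_stage.simps[of \<alpha>] I_stage.simps[of \<beta>] by (rule monoD[OF mono_I]) (auto intro: less_le_trans)

lemma countable_atMost_ordinal: "countable {..\<beta> :: countable_ordinal}"
proof -
  include cardinal_syntax
  let ?r = "cardSuc natLeq"
  have co: "Card_order ?r" by (rule cardSuc_Card_order[OF natLeq_Card_order])
  have "|underS ?r (Rep_countable_ordinal \<beta>)| <o ?r"
    using card_of_underS[OF co Rep_countable_ordinal] .
  then have "|underS ?r (Rep_countable_ordinal \<beta>)| \<le>o natLeq"
    using cardSuc_ordLeq_ordLess[OF natLeq_Card_order card_of_Card_order] by blast
  then have "|underS ?r (Rep_countable_ordinal \<beta>)| \<le>o |UNIV :: nat set|"
    using card_of_nat ordLeq_ordIso_trans ordIso_symmetric by blast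
  then have "countable (underS ?r (Rep_countable_ordinal \<beta>))"
    unfolding countable_def card_of_ordLeq[symmetric] by auto
  moreover have "Rep_countable_ordinal ` {..<\<beta>} \<subseteq> underS ?r (Rep_countable_ordinal \<beta>)"
    by (auto simp: underS_def less_countable_ordinal_def less_eq_countable_ordinal_def
        Rep_countable_ordinal_inject)
  ultimately have "countable (Rep_countable_ordinal ` {..<\<beta>})"
    by (rule countable_subset[rotated])
  then have "countable {..<\<beta>}"
    by (rule countable_image_inj_on) (auto simp: inj_on_def Rep_countable_ordinal_inject)
  moreover have "{..\<beta>} = insert \<beta> {..<\<beta>}" by auto
  ultimately show ?thesis by simp
qed

lemma uncountable_ordinals: "uncountable (UNIV :: countable_ordinal set)"
proof
  include cardinal_syntax
  let ?r = "cardSuc natLeq"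
  assume "countable (UNIV :: countable_ordinal set)"
  then have "countable (range Rep_countable_ordinal)" by simp
  then have "countable (Field ?r)"
    by (simp add: type_definition.Rep_range[OF type_definition_countable_ordinal])
  then have "|Field ?r| \<le>o |UNIV :: nat set|"
    unfolding countable_def card_of_ordLeq[symmetric] by auto
  then have "?r \<le>o natLeq"
    using card_of_Field_ordIso[OF cardSuc_Card_order[OF natLeq_Card_order]] card_of_nat
      ordIso_ordLeq_trans ordLeq_ordIso_trans ordIso_symmetric by blast
  moreover have "natLeq <o ?r" by (rule cardSuc_greater[OF natLeq_Card_order])
  ultimately show False using not_ordLess_ordLeq by blast
qed

lemma countable_bounded: "\<exists>\<beta>. \<forall>n. \<alpha> n < \<beta>" for \<alpha> :: "nat \<Rightarrow> countable_ordinal"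
proof -
  have "countable (\<Union>n. {..\<alpha> n})" using countable_atMost_ordinal by auto
  then have "(\<Union>n. {..\<alpha> n}) \<noteq> UNIV" using uncountable_ordinals by metis
  then obtain \<beta> where "\<beta> \<notin> (\<Union>n. {..\<alpha> n})" by blast
  then show ?thesis by (auto simp: not_le)
qed

lemma step_Union_I_stage:
  "step (\<Union>\<alpha>. I_stage \<alpha>) P X c c' \<Longrightarrow> \<exists>\<alpha>. step (I_stage \<alpha>) P X c c'"
  by (erule step.cases) (blast intro: step.intros)+

lemma rtranclp_step_Union_I_stage:
  "(step (\<Union>\<alpha>. I_stage \<alpha>) P X)\<^sup>*\<^sup>* c c' \<Longrightarrow> \<exists>\<alpha>. (step (I_stage \<alpha>) P X)\<^sup>*\<^sup>* c c'"
proof (induction rule: rtranclp_induct)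
  case (step c' c'')
  then obtain \<alpha> \<beta> where 1: "(step (I_stage \<alpha>) P X)\<^sup>*\<^sup>* c c'" and 2: "step (I_stage \<beta>) P X c' c''"
    using step_Union_I_stage by blast
  have "I_stage \<alpha> \<subseteq> I_stage (max \<alpha> \<beta>)" "I_stage \<beta> \<subseteq> I_stage (max \<alpha> \<beta>)"
    by (simp_all add: I_stage_subset)
  from rtranclp_step_mono[OF this(1) 1] step_mono[OF this(2) 2]
  have "(step (I_stage (max \<alpha> \<beta>)) P X)\<^sup>*\<^sup>* c c''"
    by (rule rtranclp.rtrancl_into_rtrancl)
  then show ?case by blast
qed blast

theorem I_infty_eq_Union_I_stage: "I_infty = (\<Union>\<alpha>. I_stage \<alpha>)"
proof
  have "I_stage \<alpha> \<subseteq> I_infty" for \<alpha>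
  proof (induction \<alpha> rule: less_induct)
    case (less \<alpha>)
    then have "I_stage \<alpha> \<subseteq> I_op I_infty"
      unfolding I_stage.simps[of \<alpha>] by (intro monoD[OF mono_I]) auto
    also have "I_op I_infty = I_infty"
      unfolding I_infty_def by (rule lfp_fixpoint[OF mono_I])
    finally show ?case .
  qed
  then show "(\<Union>\<alpha>. I_stage \<alpha>) \<subseteq> I_infty" by blast
next
  have stage: "I_op (I_stage \<alpha>) \<subseteq> (\<Union>\<alpha>. I_stage \<alpha>)" for \<alpha>
  proof -
    obtain \<beta> where "\<alpha> < \<beta>" using countable_bounded[of "\<lambda>_. \<alpha>"] by blast
    then have "I_op (I_stage \<alpha>) \<subseteq> I_stage \<beta>"
      unfolding I_stage.simps[of \<beta>] by (intro monoD[OF mono_I]) auto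
    then show ?thesis by blast
  qed
  have "I_op (\<Union>\<alpha>. I_stage \<alpha>) \<subseteq> (\<Union>\<alpha>. I_stage \<alpha>)"
  proof (rule subrelI, clarify)
    fix e m X r assume "((e, m, X), r) \<in> I_op (\<Union>\<alpha>. I_stage \<alpha>)"
    then show "((e, m, X), r) \<in> (\<Union>\<alpha>. I_stage \<alpha>)"
    proof (cases rule: I_op_cases)
      case (converges c)
      then obtain \<alpha> where "(step (I_stage \<alpha>) (program_of e) X)\<^sup>*\<^sup>* (initial_config m) c"
        using rtranclp_step_Union_I_stage by blast
      then have "((e, m, X), r) \<in> I_op (I_stage \<alpha>)"
        using converges(1,3) by (simp add: I_op_converges)
      then show ?thesis using stage by blast
    next
      case (diverges f)
      have "\<forall>n. \<exists>\<alpha>. step (I_stage \<alpha>) (program_of e) X (f n) (f (Suc n))"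
        using step_Union_I_stage[OF diverges(3)] by blast
      then obtain \<alpha> where \<alpha>: "\<And>n. step (I_stage (\<alpha> n)) (program_of e) X (f n) (f (Suc n))"
        unfolding choice_iff by blast
      obtain \<beta> where "\<And>n. \<alpha> n < \<beta>" using countable_bounded by blast
      then have "step (I_stage \<beta>) (program_of e) X (f n) (f (Suc n))" for n
        by (intro step_mono[OF I_stage_subset \<alpha>] less_imp_le)
      then have "((e, m, X), r) \<in> I_op (I_stage \<beta>)"
        using I_op_diverges[of f, OF diverges(2)] diverges(1) by simp
      then show ?thesis using stage by blast
    qed
  qed
  then show "I_infty \<subseteq> (\<Union>\<alpha>. I_stage \<alpha>)"
    unfolding I_infty_def by (rule lfp_lowerbound)
qed

lemma rank_less_omega1_iff: "\<rho> \<gamma> < \<omega>\<^sub>1 \<longleftrightarrow> \<gamma> \<in> Domain I_infty"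
  unfolding rank_def I_infty_eq_Union_I_stage by (auto simp: less_ordinal_le_omega1_def)

lemma step_deterministic:
  assumes "single_valued C"
  shows "step C P X c c1 \<Longrightarrow> step C P X c c2 \<Longrightarrow> c1 = c2"
  using assms by (elim step.cases) (auto dest: single_valuedD)

lemma halted_no_step: "halted P c \<Longrightarrow> \<not> step C P X c c'"
  by (auto simp: halted_def elim: step.cases)

lemma single_valued_I: assumes C: "single_valued C" shows "single_valued (I_op C)"
proof -
  have conv_conv: "c = c'" if "(step C P X)\<^sup>*\<^sup>* b c" "halted P c" "(step C P X)\<^sup>*\<^sup>* b c'" "halted P c'"
    for P X b c c'
    using that
  proof (induction rule: converse_rtranclp_induct)
    case base
    then show ?case by (metis converse_rtranclpE halted_no_step)
  next
    case (step y z)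
    from step.prems(2) show ?case
    proof (cases rule: converse_rtranclpE)
      case base
      then show ?thesis using step.hyps(1) step.prems(3) halted_no_step by blast
    next
      case (step z')
      then have "z' = z" using step_deterministic[OF C] \<open>step C P X y z\<close> by blast
      then show ?thesis using step(2) that(2) that(4) \<open>\<lbrakk>halted P c; (step C P X)\<^sup>*\<^sup>* z c'; halted P c'\<rbrakk> \<Longrightarrow> c = c'\<close>
        by blast
    qed
  qed
  have conv_div: False
    if "(step C P X)\<^sup>*\<^sup>* b c" "halted P c" "f 0 = b" "\<And>n. step C P X (f n) (f (Suc n))"
    for P X b c f
  proof -
    from that(1) have "\<exists>n. f n = c"
    proof (induction rule: rtranclp_induct)
      case base
      show ?case using that(3) by blast
    next
      case (step y z)
      then show ?case using that(4) step_deterministic[OF C] by metis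
    qed
    then show False using that(2,4) halted_no_step by metis
  qed
  show ?thesis
  proof (rule single_valuedI, clarify)
    fix e m X y z
    assume "((e, m, X), y) \<in> I_op C" "((e, m, X), z) \<in> I_op C"
    then show "y = z"
    proof (elim I_op_cases)
      fix c c'
      assume "y = Conv (tape_value c 0)" "z = Conv (tape_value c' 0)"
        and "(step C (program_of e) X)\<^sup>*\<^sup>* (initial_config m) c" "halted (program_of e) c"
        and "(step C (program_of e) X)\<^sup>*\<^sup>* (initial_config m) c'" "halted (program_of e) c'"
      then show ?thesis using conv_conv by blast
    qed (use conv_div in blast)+
  qed
qed

lemma single_valued_I_stage: "single_valued (I_stage \<alpha>)"
proof (induction \<alpha> rule: less_induct)
  case (less \<alpha>)
  have "single_valued (\<Union>\<beta>\<in>{\<beta>. \<beta> < \<alpha>}. I_stage \<beta>)"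
  proof (rule single_valuedI, clarify)
    fix x y z \<beta> \<beta>'
    assume "\<beta> < \<alpha>" "\<beta>' < \<alpha>" "(x, y) \<in> I_stage \<beta>" "(x, z) \<in> I_stage \<beta>'"
    then show "y = z"
      using less I_stage_subset linear[of \<beta> \<beta>'] unfolding single_valued_def by blast
  qed
  then show ?case unfolding I_stage.simps[of \<alpha>] by (rule single_valued_I)
qed

theorem single_valued_I_infty: "single_valued I_infty"
proof (rule single_valuedI)
  fix x y z assume "(x, y) \<in> I_infty" "(x, z) \<in> I_infty"
  then obtain \<alpha> \<beta> where "(x, y) \<in> I_stage \<alpha>" "(x, z) \<in> I_stage \<beta>"
    unfolding I_infty_eq_Union_I_stage by blast
  then show "y = z"
    using I_stage_subset linear[of \<alpha> \<beta>] single_valued_I_stage unfolding single_valued_def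
    by blast
qed

end

theory Submission
  imports Defs
begin

text \<open>
  Let \<open>K(\<gamma>, \<delta>)\<close> be the computation that runs \<open>\<gamma>\<close> and, whenever \<open>\<gamma>\<close> is about to make a query \<open>\<gamma>'\<close>,
  first asks whether \<open>K(\<delta>, \<gamma>')\<close> converges: if not, \<open>K(\<gamma>, \<delta>)\<close> halts; if so, the query \<open>\<gamma>'\<close> is
  actually made and the run goes on. If \<open>\<gamma>\<close> halts, \<open>K(\<gamma>, \<delta>)\<close> loops. When \<open>\<gamma>\<close> or \<open>\<delta>\<close> has a rank,
  \<open>K(\<gamma>, \<delta>)\<close> converges if \<open>\<rho> \<delta> < \<rho> \<gamma>\<close> and diverges otherwise: \<open>\<rho> \<delta> < \<rho> \<gamma>\<close> means that some query
  \<open>\<gamma>'\<close> of \<open>\<gamma>\<close> has \<open>\<rho> \<delta> \<le> \<rho> \<gamma>'\<close>, i.e. \<open>K(\<delta>, \<gamma>')\<close> diverges, and a query \<open>\<gamma>'\<close> is only made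
  once it is known to have a rank. By induction on the rank of \<open>\<gamma>\<close> one obtains this first for
  \<open>K(\<gamma>, \<delta>)\<close> and then for \<open>K(\<delta>, \<gamma>)\<close>, for all \<open>\<delta>\<close>. So \<open>G\<close> asks whether \<open>K(\<gamma>, \<delta>)\<close> converges.

  All queries of \<open>K\<close> have the oracle \<open>X \<oplus> Y\<close>; therefore \<open>\<gamma>'\<close> is asked in the form of its simulation by
  a universal program that uses one half of the oracle.
\<close>

section \<open>Register programs on Turing machines\<close>

text \<open>
  \<open>Loop r c\<close> repeats ``decrement \<open>r\<close>, then do \<open>c\<close>'' until \<open>r\<close> is \<open>0\<close>; \<open>Branch r c d\<close> decrements \<open>r\<close> and
  does \<open>c\<close> if \<open>r\<close> is not \<open>0\<close>, and does \<open>d\<close> otherwise. \<open>Oracle i r\<close> and \<open>Query i j r\<close> increment \<open>r\<close> if the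
  answer is yes, respectively ``converges''.
\<close>

datatype com =
    Skip
  | Inc nat
  | Oracle nat nat
  | Query nat nat nat
  | Seq com com (infixr \<open>;;\<close> 60)
  | Loop nat com
  | Branch nat com com

fun len :: "com \<Rightarrow> nat" where
  "len Skip = 0"
| "len (Inc r) = 1"
| "len (Oracle i r) = 2"
| "len (Query i j r) = 2"
| "len (c ;; d) = len c + len d"
| "len (Loop r c) = len c + 3"
| "len (Branch r c d) = len c + len d + 3"

text \<open>States are absolute addresses, so the code depends on its position \<open>p\<close>.
  Loops and branches open with a two-instruction test: step left, then either erase the
  \<open>1\<close> found there or, on a blank, jump past \<open>c\<close>.\<close>

fun code :: "com \<Rightarrow> nat \<Rightarrow> program" where
  "code Skip p = []"
| "code (Inc r) p = [Act r [(0, 1, Right, p + 1)]]"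
| "code (Oracle i r) p = [Oracle_Query i (p + 1) (p + 2), Act r [(0, 1, Right, p + 2)]]"
| "code (Query i j r) p = [Feedback_Query i j (p + 1) (p + 2), Act r [(0, 1, Right, p + 2)]]"
| "code (c ;; d) p = code c p @ code d (p + len c)"
| "code (Loop r c) p =
    [Act r [(0, 0, Left, p + 1)], Act r [(1, 0, Stay, p + 2), (0, 0, Stay, p + len c + 3)]]
    @ code c (p + 2) @ [Act r [(0, 0, Stay, p)]]"
| "code (Branch r c d) p =
    [Act r [(0, 0, Left, p + 1)], Act r [(1, 0, Stay, p + 2), (0, 0, Stay, p + len c + 3)]]
    @ code c (p + 2) @ [Act r [(0, 0, Stay, p + len c + len d + 3)]] @ code d (p + len c + 3)"

lemma length_code [simp]: "length (code c p) = len c"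
  by (induction c arbitrary: p) auto

fun code_at :: "program \<Rightarrow> nat \<Rightarrow> program \<Rightarrow> bool" where
  "code_at P p [] \<longleftrightarrow> True"
| "code_at P p (a # as) \<longleftrightarrow> p < length P \<and> P ! p = a \<and> code_at P (Suc p) as"

lemma code_at_append [simp]:
  "code_at P p (as @ bs) \<longleftrightarrow> code_at P p as \<and> code_at P (p + length as) bs"
  by (induction as arbitrary: p) auto

lemma code_at_self: "code_at (as @ bs) (length as) bs"
proof (induction bs arbitrary: as)
  case (Cons b bs)
  from Cons[of "as @ [b]"] show ?case by simp
qed simp

text \<open>
  Each head rests on the first blank behind the unary number on its tape. Zero is then detected by
  moving left: the head stays on a blank exactly if it was at the left end.
\<close>

definition reg_config :: "(nat \<Rightarrow> nat) \<Rightarrow> nat \<Rightarrow> config" where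
  "reg_config R p = \<lparr>state = p, cells = (\<lambda>i n. if n < R i then 1 else 0), head = R\<rparr>"

lemma reg_config_simps [simp]:
  "state (reg_config R p) = p" "scanned (reg_config R p) i = 0" "tape_value (reg_config R p) i = R i"
  "head (reg_config R p) = R"
  unfolding reg_config_def scanned_def tape_value_def
  by (auto intro!: Least_equality split: if_splits)

lemma state_update_reg_config [simp]: "reg_config R p\<lparr>state := q\<rparr> = reg_config R q"
  by (simp add: reg_config_def)

lemma stepI:
  assumes "state c < length P" "P ! state c = Act i \<delta>" "map_of \<delta> (scanned c i) = Some (s, d, q)"
    "c' = \<lparr>state = q, cells = (cells c)(i := (cells c i)(head c i := s)),
            head = (head c)(i := move_head d (head c i))\<rparr>"
  shows "step C P X c c'"
  using act[OF assms(1-3)] assms(4) by simp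

lemma step_Inc:
  assumes "code_at P p [Act r [(0, 1, Right, q)]]"
  shows "step C P X (reg_config R p) (reg_config (R(r := Suc (R r))) q)"
  by (rule stepI[where i=r and \<delta>="[(0, 1, Right, q)]" and s=1 and d=Right and q=q])
     (use assms in \<open>auto simp: reg_config_def scanned_def fun_eq_iff less_Suc_eq\<close>)

lemma step_jump:
  assumes "code_at P p [Act r [(0, 0, Stay, q)]]"
  shows "step C P X (reg_config R p) (reg_config R q)"
  by (rule stepI[where i=r and \<delta>="[(0, 0, Stay, q)]" and s=0 and d=Stay and q=q])
     (use assms in \<open>auto simp: reg_config_def scanned_def fun_eq_iff\<close>)

text \<open>Left of the resting place lies the last \<open>1\<close> of the number or, at the left
  end, the same blank again. Writing a blank and staying there gives a register configuration in
  both cases.\<close>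

lemma step_test:
  assumes "code_at P p [Act r [(0, 0, Left, Suc p)], Act r [(1, 0, Stay, q), (0, 0, Stay, q')]]"
  shows "(step C P X)\<^sup>+\<^sup>+ (reg_config R p)
    (if R r = 0 then reg_config R q' else reg_config (R(r := R r - 1)) q)"
proof -
  let ?c = "\<lparr>state = Suc p, cells = (\<lambda>i n. if n < R i then 1 else 0), head = R(r := R r - 1)\<rparr>"
  have "step C P X (reg_config R p) ?c"
    by (rule stepI[where i=r and \<delta>="[(0, 0, Left, Suc p)]" and s=0 and d=Left and q="Suc p"])
       (use assms in \<open>auto simp: reg_config_def scanned_def fun_eq_iff\<close>)
  moreover have "step C P X ?c
      (if R r = 0 then reg_config R q' else reg_config (R(r := R r - 1)) q)"
  proof (cases "R r = 0")
    case True
    have "step C P X ?c (reg_config R q')"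
      by (rule stepI[where i=r and \<delta>="[(1, 0, Stay, q), (0, 0, Stay, q')]"
            and d=Stay and s=0 and q=q'])
         (use assms True in \<open>simp_all add: reg_config_def scanned_def fun_eq_iff\<close>)
    with True show ?thesis by simp
  next
    case False
    have "step C P X ?c (reg_config (R(r := R r - 1)) q)"
      by (rule stepI[where i=r and \<delta>="[(1, 0, Stay, q), (0, 0, Stay, q')]"
            and d=Stay and s=0 and q=q])
         (use assms False in \<open>auto simp: reg_config_def scanned_def fun_eq_iff\<close>)
    with False show ?thesis by simp
  qed
  ultimately show ?thesis by (rule tranclp.trancl_into_trancl[OF tranclp.r_into_trancl])
qed

text \<open>Quantifying over all programs and addresses that carry the code makes composition
  independent of placement.\<close>

definition exec :: "(comp \<times> outcome) set \<Rightarrow> oracle_set \<Rightarrow> com \<Rightarrow> (nat \<Rightarrow> nat) \<Rightarrow> (nat \<Rightarrow> nat) \<Rightarrow> bool" where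
  "exec C X c R R' \<longleftrightarrow> (\<forall>P p. code_at P p (code c p) \<longrightarrow>
    (step C P X)\<^sup>*\<^sup>* (reg_config R p) (reg_config R' (p + len c)))"

lemma execD:
  "exec C X c R R' \<Longrightarrow> code_at P p (code c p) \<Longrightarrow> q = p + len c \<Longrightarrow>
    (step C P X)\<^sup>*\<^sup>* (reg_config R p) (reg_config R' q)"
  by (simp add: exec_def)

lemma exec_Skip: "R' = R \<Longrightarrow> exec C X Skip R R'"
  by (simp add: exec_def)

lemma exec_Inc: "R' = R(r := Suc (R r)) \<Longrightarrow> exec C X (Inc r) R R'"
  unfolding exec_def using step_Inc by (auto intro!: r_into_rtranclp)

lemma exec_Seq: "exec C X c R R' \<Longrightarrow> exec C X d R' R'' \<Longrightarrow> exec C X (c ;; d) R R''"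
  unfolding exec_def by (simp add: add.assoc[symmetric]) (meson rtranclp_trans)

lemma exec_Oracle: "exec C X (Oracle i r) R (R(r := R r + of_bool (X (R i))))"
  unfolding exec_def
proof (intro allI impI)
  fix P p assume at: "code_at P p (code (Oracle i r) p)"
  then have "step C P X (reg_config R p) (reg_config R (if X (R i) then p + 1 else p + 2))"
    using oracle_query[of "reg_config R p" P i "p + 1" "p + 2" C X] by auto
  moreover have "step C P X (reg_config R (p + 1)) (reg_config (R(r := Suc (R r))) (p + 2))"
    using at by (intro step_Inc) auto
  ultimately show "(step C P X)\<^sup>*\<^sup>* (reg_config R p)
      (reg_config (R(r := R r + of_bool (X (R i)))) (p + len (Oracle i r)))"
    by (cases "X (R i)") (auto intro: converse_rtranclp_into_rtranclp)
qed

lemma exec_Query: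
  assumes "((R i, R j, X), res) \<in> C"
  shows "exec C X (Query i j r) R (R(r := R r + of_bool (res \<noteq> Div)))"
  unfolding exec_def
proof (intro allI impI)
  fix P p assume at: "code_at P p (code (Query i j r) p)"
  then have "step C P X (reg_config R p) (reg_config R (if res \<noteq> Div then p + 1 else p + 2))"
    using query_conv[of "reg_config R p" P i j "p + 1" "p + 2" X _ C]
      query_div[of "reg_config R p" P i j "p + 1" "p + 2" X C] assms by (cases res) auto
  moreover have "step C P X (reg_config R (p + 1)) (reg_config (R(r := Suc (R r))) (p + 2))"
    using at by (intro step_Inc) auto
  ultimately show "(step C P X)\<^sup>*\<^sup>* (reg_config R p)
      (reg_config (R(r := R r + of_bool (res \<noteq> Div))) (p + len (Query i j r)))"
    by (cases "res = Div") (auto intro: converse_rtranclp_into_rtranclp)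
qed

text \<open>Needed besides \<open>exec\<close>, which only describes terminating runs: an endless
  loop passes address \<open>p\<close> again and again, each time after at least one step.\<close>

lemma Loop_iteration:
  assumes at: "code_at P p (code (Loop r c) p)" and "R r \<noteq> 0"
    and body: "exec C X c (R(r := R r - 1)) R'"
  shows "(step C P X)\<^sup>+\<^sup>+ (reg_config R p) (reg_config R' p)"
proof -
  have "(step C P X)\<^sup>+\<^sup>+ (reg_config R p) (reg_config (R(r := R r - 1)) (p + 2))"
    using step_test[of P p r "p + 2" "p + len c + 3" C X R] at \<open>R r \<noteq> 0\<close> by simp
  moreover have "(step C P X)\<^sup>*\<^sup>* (reg_config (R(r := R r - 1)) (p + 2)) (reg_config R' (p + 2 + len c))"
    using at by (intro execD[OF body]) auto
  moreover have "step C P X (reg_config R' (p + 2 + len c)) (reg_config R' p)"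
    using at by (intro step_jump[where r=r]) auto
  ultimately show ?thesis by (meson tranclp.trancl_into_trancl tranclp_rtranclp_tranclp)
qed

lemma Loop_exit:
  assumes at: "code_at P p (code (Loop r c) p)" and "R r = 0"
  shows "(step C P X)\<^sup>+\<^sup>+ (reg_config R p) (reg_config R (p + len c + 3))"
  using step_test[of P p r "p + 2" "p + len c + 3" C X R] assms by simp

lemma exec_Loop_0: "R r = 0 \<Longrightarrow> R' = R \<Longrightarrow> exec C X (Loop r c) R R'"
  unfolding exec_def using Loop_exit by (auto simp: add.assoc simp del: code.simps intro!: tranclp_into_rtranclp)

lemma exec_Loop_step:
  assumes "R r \<noteq> 0" "exec C X c (R(r := R r - 1)) R'" "exec C X (Loop r c) R' R''"
  shows "exec C X (Loop r c) R R''"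
  using assms(3) Loop_iteration[OF _ assms(1,2)] unfolding exec_def
  by (meson rtranclp_trans tranclp_into_rtranclp)

lemma exec_Branch:
  assumes "R r \<noteq> 0 \<Longrightarrow> exec C X c (R(r := R r - 1)) R'" "R r = 0 \<Longrightarrow> exec C X d R R'"
  shows "exec C X (Branch r c d) R R'"
  unfolding exec_def
proof (intro allI impI)
  fix P p assume at: "code_at P p (code (Branch r c d) p)"
  have test: "(step C P X)\<^sup>+\<^sup>+ (reg_config R p)
    (if R r = 0 then reg_config R (p + len c + 3) else reg_config (R(r := R r - 1)) (p + 2))"
    using at by (intro step_test) auto
  show "(step C P X)\<^sup>*\<^sup>* (reg_config R p) (reg_config R' (p + len (Branch r c d)))"
  proof (cases "R r = 0")
    case True
    have "(step C P X)\<^sup>*\<^sup>* (reg_config R (p + len c + 3)) (reg_config R' (p + len (Branch r c d)))"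
      using at True by (intro execD[OF assms(2)]) (auto simp: add_ac numeral_eq_Suc)
    then show ?thesis using test True by (simp add: rtranclp_trans tranclp_into_rtranclp)
  next
    case False
    have "(step C P X)\<^sup>*\<^sup>* (reg_config (R(r := R r - 1)) (p + 2)) (reg_config R' (p + 2 + len c))"
      using at False by (intro execD[OF assms(1)]) auto
    moreover have "step C P X (reg_config R' (p + 2 + len c)) (reg_config R' (p + len (Branch r c d)))"
      using at by (intro step_jump[where r=r]) (auto simp: add_ac)
    ultimately show ?thesis using test False
      by (simp del: len.simps)
  qed
qed

section \<open>Computable functions\<close>

lemma exec_Clear: "R' = R(a := 0) \<Longrightarrow> exec C X (Loop a Skip) R R'"
proof (induction "R a" arbitrary: R R')
  case 0
  then show ?case by (intro exec_Loop_0) (auto simp: fun_eq_iff)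
next
  case (Suc n)
  from Suc(2) show ?case
    by (intro exec_Loop_step[OF _ exec_Skip[OF refl] Suc(1)]) (auto simp: Suc(3))
qed

lemma exec_Move: "a \<noteq> b \<Longrightarrow> R' = R(a := 0, b := R b + R a) \<Longrightarrow> exec C X (Loop a (Inc b)) R R'"
proof (induction "R a" arbitrary: R R')
  case 0
  then show ?case by (intro exec_Loop_0) (auto simp: fun_eq_iff)
next
  case (Suc n)
  from Suc(2,3) show ?case
    by (intro exec_Loop_step[OF _ exec_Inc[OF refl] Suc(1)]) (auto simp: Suc(4) fun_upd_twist)
qed

lemma exec_Move2:
  "distinct [a, b, c] \<Longrightarrow> R' = R(a := 0, b := R b + R a, c := R c + R a) \<Longrightarrow>
    exec C X (Loop a (Inc b ;; Inc c)) R R'"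
proof (induction "R a" arbitrary: R R')
  case 0
  then show ?case by (intro exec_Loop_0) (auto simp: fun_eq_iff)
next
  case (Suc n)
  from Suc(2,3) show ?case
    by (intro exec_Loop_step[OF _ exec_Seq[OF exec_Inc[OF refl] exec_Inc[OF refl]] Suc(1)])
       (auto simp: Suc(4) fun_eq_iff)
qed

text \<open>Moving empties the source register, so a second copy goes to \<open>s\<close> and is
  brought back from there.\<close>

definition Copy_reg :: "nat \<Rightarrow> nat \<Rightarrow> nat \<Rightarrow> com" where
  "Copy_reg a b s = Loop a (Inc b ;; Inc s) ;; Loop s (Inc a)"

lemma exec_Copy_reg:
  "distinct [a, b, s] \<Longrightarrow> R s = 0 \<Longrightarrow> R' = R(b := R b + R a) \<Longrightarrow> exec C X (Copy_reg a b s) R R'"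
  unfolding Copy_reg_def
  by (rule exec_Seq[OF exec_Move2[OF _ refl] exec_Move]) (auto simp: fun_eq_iff)

text \<open>Cantor pairing: \<open>prod_encode (m, n) = triangle (m + n) + m\<close>. The first loop
  leaves \<open>m + n\<close> in register \<open>a + 1\<close> and \<open>m\<close> in
  \<open>a + 2\<close>; the second adds the triangular number.\<close>

definition Pair_regs :: "nat \<Rightarrow> com" where
  "Pair_regs a = Loop a (Inc (a + 1) ;; Inc (a + 2)) ;;
    Loop (a + 1) (Copy_reg (a + 1) (a + 2) (a + 3) ;; Inc (a + 2)) ;; Loop (a + 2) (Inc a)"

lemma exec_triangle:
  assumes "distinct [a, b, s]" "R s = 0" "R' = R(a := 0, b := R b + triangle (R a))"
  shows "exec C X (Loop a (Copy_reg a b s ;; Inc b)) R R'"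
  using assms
proof (induction "R a" arbitrary: R R')
  case 0
  then show ?case by (intro exec_Loop_0) (auto simp: fun_eq_iff)
next
  case (Suc n)
  from Suc(2,3) Suc(4) show ?case
    by (intro exec_Loop_step[OF _ exec_Seq[OF exec_Copy_reg[OF _ _ refl] exec_Inc[OF refl]] Suc(1)])
       (auto simp: Suc(5) fun_eq_iff Suc(2)[symmetric])
qed

lemma exec_Pair_regs:
  assumes "\<And>k. k > Suc a \<Longrightarrow> R k = 0" "R' = R(a := prod_encode (R a, R (Suc a)), Suc a := 0)"
  shows "exec C X (Pair_regs a) R R'"
  unfolding Pair_regs_def
  by (rule exec_Seq[OF exec_Move2[OF _ refl] exec_Seq[OF exec_triangle[OF _ _ refl] exec_Move]])
     (auto simp: assms fun_eq_iff prod_encode_def add.commute)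

text \<open>The Cantor enumeration runs through the antidiagonals. With this successor rule decoding
  is mere counting.\<close>

lemma prod_decode_Suc:
  "prod_decode (Suc k) = (case prod_decode k of (m, n) \<Rightarrow> if n = 0 then (0, Suc m) else (Suc m, n - 1))"
proof -
  obtain m n where mn: "prod_decode k = (m, n)" by fastforce
  then have "k = prod_encode (m, n)" by (metis prod_decode_inverse)
  then have "Suc k = prod_encode (if n = 0 then (0, Suc m) else (Suc m, n - 1))"
    by (cases n) (auto simp: prod_encode_def)
  then show ?thesis by (simp add: mn)
qed

text \<open>Register \<open>a\<close> counts down while registers \<open>a + 1\<close> and
  \<open>a + 2\<close> run through the enumeration of pairs from \<open>(0, 0)\<close>, the pair
  coded by 0.\<close>

definition Unpair_regs :: "nat \<Rightarrow> com" where
  "Unpair_regs a = Loop a (Branch (a + 2) (Inc (a + 1)) (Loop (a + 1) (Inc (a + 2)) ;; Inc (a + 2))) ;;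
    Loop (a + 1) (Inc a) ;; Loop (a + 2) (Inc (a + 1))"

lemma exec_Unpair_loop:
  assumes "distinct [a, b, c]" "(R b, R c) = prod_decode k"
    "R' = R(a := 0, b := fst (prod_decode (k + R a)), c := snd (prod_decode (k + R a)))"
  shows "exec C X (Loop a (Branch c (Inc b) (Loop b (Inc c) ;; Inc c))) R R'"
  using assms
proof (induction "R a" arbitrary: R R' k)
  case 0
  then have "prod_decode k = (R b, R c)" by simp
  with 0 show ?case by (intro exec_Loop_0) (auto simp: fun_eq_iff)
next
  case (Suc n)
  let ?S = "R(a := n, b := fst (prod_decode (Suc k)), c := snd (prod_decode (Suc k)))"
  from Suc have pd: "prod_decode k = (R b, R c)" by simp
  have "exec C X (Branch c (Inc b) (Loop b (Inc c) ;; Inc c)) (R(a := R a - 1)) ?S"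
  proof (rule exec_Branch)
    assume "(R(a := R a - 1)) c \<noteq> 0"
    then show "exec C X (Inc b) ((R(a := R a - 1))(c := (R(a := R a - 1)) c - 1)) ?S"
      using Suc.prems by (intro exec_Inc) (auto simp: fun_eq_iff prod_decode_Suc pd Suc(2)[symmetric])
  next
    assume "(R(a := R a - 1)) c = 0"
    then show "exec C X (Loop b (Inc c) ;; Inc c) (R(a := R a - 1)) ?S"
      using Suc.prems
      by (intro exec_Seq[OF exec_Move[OF _ refl] exec_Inc])
         (auto simp: fun_eq_iff prod_decode_Suc pd Suc(2)[symmetric])
  qed
  moreover have "exec C X (Loop a (Branch c (Inc b) (Loop b (Inc c) ;; Inc c))) ?S R'"
  proof (rule Suc(1)[of _ "Suc k"])
    have "k + R a = Suc (k + n)" using Suc(2) by simp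
    then show "R' = ?S(a := 0, b := fst (prod_decode (Suc k + ?S a)), c := snd (prod_decode (Suc k + ?S a)))"
      using Suc.prems by (simp add: fun_eq_iff)
  qed (use Suc.prems in auto)
  ultimately show ?case using Suc(2) by (metis exec_Loop_step nat.distinct(1))
qed

lemma exec_Unpair_regs:
  assumes "\<And>k. k > a \<Longrightarrow> R k = 0"
    "R' = R(a := fst (prod_decode (R a)), Suc a := snd (prod_decode (R a)))"
  shows "exec C X (Unpair_regs a) R R'"
proof -
  have "prod_decode 0 = (0, 0)"
    by (simp add: prod_decode_def prod_decode_aux.simps)
  then show ?thesis
    unfolding Unpair_regs_def
    by (intro exec_Seq[OF exec_Unpair_loop[where k=0, OF _ _ refl]
          exec_Seq[OF exec_Move[OF _ refl] exec_Move]])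
       (auto simp: assms fun_eq_iff)
qed

text \<open>
  The registers above \<open>a\<close> serve as scratch space, which is returned empty.
\<close>

definition computes :: "(nat \<Rightarrow> com) \<Rightarrow> (nat \<Rightarrow> nat) \<Rightarrow> bool" where
  "computes c f \<longleftrightarrow>
    (\<forall>C X a R R'. (\<forall>k>a. R k = 0) \<longrightarrow> R' = R(a := f (R a)) \<longrightarrow> exec C X (c a) R R')"

definition computable :: "(nat \<Rightarrow> nat) \<Rightarrow> bool" where
  "computable f \<longleftrightarrow> (\<exists>c. computes c f)"

named_theorems computable_intros

lemma computesD: "computes c f \<Longrightarrow> \<forall>k>a. R k = 0 \<Longrightarrow> R' = R(a := f (R a)) \<Longrightarrow> exec C X (c a) R R'"
  unfolding computes_def by blast

lemma computableI:
  "(\<And>C X a R R'. \<forall>k>a. R k = 0 \<Longrightarrow> R' = R(a := f (R a)) \<Longrightarrow> exec C X (c a) R R') \<Longrightarrow> computable f"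
  unfolding computable_def computes_def by blast

lemma computable_comp:
  assumes "computable f" "computable g"
  shows "computable (\<lambda>x. f (g x))"
proof -
  from assms obtain c d where "computes c f" "computes d g"
    unfolding computable_def by blast
  note c = computesD[OF this(1)] and d = computesD[OF this(2)]
  show ?thesis
    by (rule computableI[of _ "\<lambda>a. d a ;; c a"]) (rule exec_Seq[OF d[OF _ refl] c], auto)
qed

lemma computable_id [computable_intros]: "computable (\<lambda>x. x)"
  by (rule computableI[of _ "\<lambda>a. Skip"]) (auto intro: exec_Skip)

lemma computable_Suc [computable_intros]:
  assumes "computable f" shows "computable (\<lambda>x. Suc (f x))"
proof -
  have "computable Suc"
    by (rule computableI[of _ Inc]) (auto intro: exec_Inc)
  from computable_comp[OF this assms] show ?thesis .
qed

lemma computable_const [computable_intros]: "computable (\<lambda>x. k)"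
proof (induction k)
  case 0
  show ?case by (rule computableI[of _ "\<lambda>a. Loop a Skip"]) (auto intro: exec_Clear)
qed (rule computable_Suc)

definition fst_of :: "nat \<Rightarrow> nat" where "fst_of x = fst (prod_decode x)"
definition snd_of :: "nat \<Rightarrow> nat" where "snd_of x = snd (prod_decode x)"
definition pair :: "nat \<Rightarrow> nat \<Rightarrow> nat" where "pair x y = prod_encode (x, y)"

lemma fst_of_pair [simp]: "fst_of (pair x y) = x"
  and snd_of_pair [simp]: "snd_of (pair x y) = y"
  and pair_fst_of_snd_of [simp]: "pair (fst_of x) (snd_of x) = x"
  by (simp_all add: fst_of_def snd_of_def pair_def)

lemma computable_fst_of [computable_intros]:
  assumes "computable f" shows "computable (\<lambda>x. fst_of (f x))"
proof -
  have "computable fst_of"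
  proof (rule computableI[of _ "\<lambda>a. Unpair_regs a ;; Loop (Suc a) Skip"])
    fix C X a and R R' :: "nat \<Rightarrow> nat" assume "\<forall>k>a. R k = 0" "R' = R(a := fst_of (R a))"
    then show "exec C X (Unpair_regs a ;; Loop (Suc a) Skip) R R'"
      by (intro exec_Seq[OF exec_Unpair_regs[OF _ refl] exec_Clear]) (auto simp: fun_eq_iff fst_of_def)
  qed
  from computable_comp[OF this assms] show ?thesis .
qed

lemma computable_snd_of [computable_intros]:
  assumes "computable f" shows "computable (\<lambda>x. snd_of (f x))"
proof -
  have "computable snd_of"
  proof (rule computableI[of _ "\<lambda>a. Unpair_regs a ;; Loop a Skip ;; Loop (Suc a) (Inc a)"])
    fix C X a and R R' :: "nat \<Rightarrow> nat" assume "\<forall>k>a. R k = 0" "R' = R(a := snd_of (R a))"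
    then show "exec C X (Unpair_regs a ;; Loop a Skip ;; Loop (Suc a) (Inc a)) R R'"
      by (intro exec_Seq[OF exec_Unpair_regs[OF _ refl] exec_Seq[OF exec_Clear[OF refl] exec_Move]])
         (auto simp: fun_eq_iff snd_of_def)
  qed
  from computable_comp[OF this assms] show ?thesis .
qed

lemma computable_pair [computable_intros]:
  assumes "computable f" "computable g" shows "computable (\<lambda>x. pair (f x) (g x))"
proof -
  from assms obtain c d where "computes c f" "computes d g"
    unfolding computable_def by blast
  note c = computesD[OF this(1)] and d = computesD[OF this(2)]
  let ?c = "\<lambda>a. Copy_reg a (Suc a) (a + 2) ;; c (Suc a) ;; Copy_reg a (a + 2) (a + 3) ;; d (a + 2) ;;
    Loop a Skip ;; Loop (Suc a) (Inc a) ;; Loop (a + 2) (Inc (Suc a)) ;; Pair_regs a"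
  show ?thesis
  proof (rule computableI[of _ ?c])
    fix C X a and R R' :: "nat \<Rightarrow> nat" assume "\<forall>k>a. R k = 0" "R' = R(a := pair (f (R a)) (g (R a)))"
    then show "exec C X (?c a) R R'"
      by (intro exec_Seq[OF exec_Copy_reg[OF _ _ refl] exec_Seq[OF c[OF _ refl]
            exec_Seq[OF exec_Copy_reg[OF _ _ refl] exec_Seq[OF d[OF _ refl] exec_Seq[OF exec_Clear[OF refl]
            exec_Seq[OF exec_Move[OF _ refl] exec_Seq[OF exec_Move[OF _ refl] exec_Pair_regs]]]]]]])
         (auto simp: fun_eq_iff pair_def)
  qed
qed

text \<open>Later case distinctions, arithmetic and bounded searches are all reduced to iteration
  with a computed number of rounds.\<close>

lemma computable_iterate:
  assumes "computable f" shows "computable (\<lambda>x. (f ^^ fst_of x) (snd_of x))"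
proof -
  from assms obtain c where "computes c f"
    unfolding computable_def by blast
  note c = computesD[OF this]
  have loop: "exec C X (Loop a (c (Suc a))) R R'"
    if "\<forall>k>Suc a. R k = 0" "R' = R(a := 0, Suc a := (f ^^ R a) (R (Suc a)))" for C X a R R'
    using that
  proof (induction "R a" arbitrary: R R')
    case 0
    then show ?case by (intro exec_Loop_0) (auto simp: fun_eq_iff)
  next
    case (Suc n)
    from Suc(2,3) show ?case
      by (intro exec_Loop_step[OF _ c[OF _ refl] Suc(1)])
         (auto simp: Suc(4) fun_eq_iff Suc(2)[symmetric] funpow_swap1)
  qed
  show ?thesis
  proof (rule computableI[of _ "\<lambda>a. Unpair_regs a ;; Loop a (c (Suc a)) ;; Loop (Suc a) (Inc a)"])
    fix C X a and R R' :: "nat \<Rightarrow> nat"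
    assume "\<forall>k>a. R k = 0" "R' = R(a := (f ^^ fst_of (R a)) (snd_of (R a)))"
    then show "exec C X (Unpair_regs a ;; Loop a (c (Suc a)) ;; Loop (Suc a) (Inc a)) R R'"
      by (intro exec_Seq[OF exec_Unpair_regs[OF _ refl] exec_Seq[OF loop[OF _ refl] exec_Move]])
         (auto simp: fun_eq_iff fst_of_def snd_of_def)
  qed
qed

text \<open>\<open>S\<close> consists of checkpoints. Whatever can still reach a checkpoint has a
  successor with the same property, since the path can be prolonged to a further checkpoint;
  iterating a choice of successors gives the run.\<close>

lemma infinite_run:
  assumes "x \<in> S" "\<And>x. x \<in> S \<Longrightarrow> \<exists>y\<in>S. r\<^sup>+\<^sup>+ x y"
  shows "\<exists>f. f 0 = x \<and> (\<forall>n. r (f n) (f (Suc n)))"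
proof -
  let ?T = "{y. \<exists>z\<in>S. r\<^sup>*\<^sup>* y z}"
  have "\<exists>z\<in>?T. r y z" if "y \<in> ?T" for y
  proof -
    from that obtain z where "z \<in> S" "r\<^sup>*\<^sup>* y z" by blast
    then obtain z' where "z' \<in> S" "r\<^sup>+\<^sup>+ y z'" using assms(2) by (meson rtranclp_tranclp_tranclp)
    then show ?thesis by (auto dest: tranclpD)
  qed
  then obtain g where g: "\<And>y. y \<in> ?T \<Longrightarrow> g y \<in> ?T \<and> r y (g y)" by metis
  have "(g ^^ n) x \<in> ?T" for n
  proof (induction n)
    case 0
    then show ?case using assms(1) by auto
  next
    case (Suc n)
    then show ?case using g by simp
  qed
  then show ?thesis using g by (intro exI[of _ "\<lambda>n. (g ^^ n) x"]) auto
qed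

lemma I_infty_fixpoint: "I_op I_infty = I_infty"
  unfolding I_infty_def by (rule lfp_fixpoint[OF mono_I])

section \<open>Closure properties of computable functions\<close>

lemma computable_funpow [computable_intros]:
  assumes "computable (\<lambda>z. F (fst_of z) (snd_of z))" "computable n" "computable g"
  shows "computable (\<lambda>x. (F x ^^ n x) (g x))"
proof -
  \<comment> \<open>The iterated function has no parameter, so \<open>x\<close> is carried along in
    the first component.\<close>
  let ?H = "\<lambda>z. pair (fst_of z) (F (fst_of z) (snd_of z))"
  have "(?H ^^ k) (pair x y) = pair x ((F x ^^ k) y)" for k x y
    by (induction k) auto
  moreover have "computable (\<lambda>x. snd_of ((?H ^^ fst_of (pair (n x) (pair x (g x))))
      (snd_of (pair (n x) (pair x (g x))))))"
    by (intro computable_snd_of computable_comp[OF computable_iterate] computable_pair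
        computable_fst_of computable_id assms)
  ultimately show ?thesis by simp
qed

lemma computable_if_0:
  assumes "computable f" "computable g" "computable h"
  shows "computable (\<lambda>x. if f x = 0 then g x else h x)"
proof -
  have "((\<lambda>_. h x) ^^ f x) (g x) = (if f x = 0 then g x else h x)" for x
    by (cases "f x") auto
  moreover have "computable (\<lambda>x. ((\<lambda>_. h x) ^^ f x) (g x))"
    by (intro computable_funpow computable_comp[OF assms(3)] computable_fst_of computable_id assms)
  ultimately show ?thesis by simp
qed

definition decidable :: "(nat \<Rightarrow> bool) \<Rightarrow> bool" where
  "decidable Q \<longleftrightarrow> computable (\<lambda>x. if Q x then 1 else 0)"

lemma computable_if [computable_intros]:
  assumes "decidable Q" "computable f" "computable g"
  shows "computable (\<lambda>x. if Q x then f x else g x)"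
  using computable_if_0[OF assms(1)[unfolded decidable_def] assms(3,2)]
  by (rule back_subst[of computable]) auto

lemma decidable_eq_0: "computable f \<Longrightarrow> decidable (\<lambda>x. f x = 0)"
  unfolding decidable_def by (intro computable_if_0 computable_const)

lemma decidable_not [computable_intros]: "decidable Q \<Longrightarrow> decidable (\<lambda>x. \<not> Q x)"
  unfolding decidable_def[of "\<lambda>x. \<not> Q x"] 
  by (rule back_subst[of computable, OF computable_if[of Q "\<lambda>_. 0" "\<lambda>_. 1"]]) (auto intro: computable_const)

lemma decidable_conj [computable_intros]:
  "decidable Q \<Longrightarrow> decidable R \<Longrightarrow> decidable (\<lambda>x. Q x \<and> R x)"
  unfolding decidable_def[of "\<lambda>x. Q x \<and> R x"] 
  by (rule back_subst[of computable, OF computable_if[of Q "\<lambda>x. if R x then 1 else 0" "\<lambda>_. 0"]])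
     (auto intro: computable_const simp: decidable_def)

lemma decidable_disj [computable_intros]:
  "decidable Q \<Longrightarrow> decidable R \<Longrightarrow> decidable (\<lambda>x. Q x \<or> R x)"
  using decidable_not[OF decidable_conj[OF decidable_not decidable_not]] by simp

lemma computable_pred:
  assumes "computable f" shows "computable (\<lambda>x. f x - 1)"
proof -
  let ?H = "\<lambda>z. pair (Suc (fst_of z)) (fst_of z)"
  have "(?H ^^ n) (pair 0 0) = pair n (n - 1)" for n
    by (induction n) auto
  moreover have "computable (\<lambda>x. snd_of ((?H ^^ f x) (pair 0 0)))"
    by (intro computable_intros assms)
  ultimately show ?thesis by simp
qed

lemma computable_minus [computable_intros]:
  assumes "computable f" "computable g" shows "computable (\<lambda>x. f x - g x)"
proof -
  have "((\<lambda>y. y - 1) ^^ n) m = m - n" for m n :: nat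
    by (induction n) auto
  moreover have "computable (\<lambda>x. ((\<lambda>y. y - 1) ^^ g x) (f x))"
    by (intro computable_intros computable_pred assms)
  ultimately show ?thesis by simp
qed

lemma computable_plus [computable_intros]:
  assumes "computable f" "computable g" shows "computable (\<lambda>x. f x + g x)"
proof -
  have "(Suc ^^ n) m = n + m" for m n
    by (induction n) auto
  moreover have "computable (\<lambda>x. (Suc ^^ f x) (g x))"
    by (intro computable_intros assms)
  ultimately show ?thesis by simp
qed

lemma decidable_eq [computable_intros]:
  assumes "computable f" "computable g" shows "decidable (\<lambda>x. f x = g x)"
proof -
  have "decidable (\<lambda>x. (f x - g x) + (g x - f x) = 0)"
    by (intro decidable_eq_0 computable_plus computable_minus assms)
  moreover have "(f x - g x) + (g x - f x) = 0 \<longleftrightarrow> f x = g x" for x by auto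
  ultimately show ?thesis by simp
qed

lemma decidable_less [computable_intros]:
  assumes "computable f" "computable g" shows "decidable (\<lambda>x. f x < g x)"
proof -
  have "decidable (\<lambda>x. \<not> g x - f x = 0)"
    by (intro decidable_not decidable_eq_0 computable_minus assms)
  then show ?thesis by (simp add: not_le)
qed

lemma div_mod_3_funpow:
  "((\<lambda>z. if snd_of z = 2 then pair (Suc (fst_of z)) 0 else pair (fst_of z) (Suc (snd_of z))) ^^ n)
    (pair 0 0) = pair (n div 3) (n mod 3)"
proof (induction n)
  case (Suc n)
  then show ?case by (auto simp: mod_Suc div_Suc)
qed simp

lemma computable_div_3 [computable_intros]:
  assumes "computable f" shows "computable (\<lambda>x. f x div 3)"
proof -
  have "computable (\<lambda>x. fst_of (((\<lambda>z. if snd_of z = 2 then pair (Suc (fst_of z)) 0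
      else pair (fst_of z) (Suc (snd_of z))) ^^ f x) (pair 0 0)))"
    by (intro computable_intros assms)
  then show ?thesis unfolding div_mod_3_funpow by simp
qed

lemma computable_mod_3 [computable_intros]:
  assumes "computable f" shows "computable (\<lambda>x. f x mod 3)"
proof -
  have "computable (\<lambda>x. snd_of (((\<lambda>z. if snd_of z = 2 then pair (Suc (fst_of z)) 0
      else pair (fst_of z) (Suc (snd_of z))) ^^ f x) (pair 0 0)))"
    by (intro computable_intros assms)
  then show ?thesis unfolding div_mod_3_funpow by simp
qed

section \<open>Compilation of drivers into Turing programs\<close>

text \<open>
  A driver is a loop on a number \<open>x\<close> that ends as soon as \<open>x < 2\<close>. Every iteration makes exactly one
  oracle query and one feedback query.
\<close>

definition driver_step ::
    "(nat \<Rightarrow> nat) \<Rightarrow> (nat \<Rightarrow> nat) \<Rightarrow> (nat \<Rightarrow> nat) \<Rightarrow> (nat \<Rightarrow> nat \<Rightarrow> nat \<Rightarrow> nat) \<Rightarrow> oracle_set \<Rightarrow>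
      nat \<Rightarrow> nat \<Rightarrow> bool" where
  "driver_step ask prog inp upd X x y \<longleftrightarrow> 2 \<le> x \<and>
    (\<exists>res. ((prog x, inp x, X), res) \<in> I_infty \<and>
      y = upd x (of_bool (X (ask x))) (of_bool (res \<noteq> Div)))"

text \<open>The heads start at the left end instead of behind the numbers. The instruction in state
  0 walks head 0 across the input; the other tapes are empty and already in register form.\<close>

lemma load_input:
  assumes "code_at P 0 [Act 0 [(1, 1, Right, 0), (0, 0, Stay, 1)]]"
  shows "(step C P X)\<^sup>*\<^sup>* (initial_config m) (reg_config ((\<lambda>_. 0)(0 := m)) 1)"
proof -
  let ?c = "\<lambda>k. \<lparr>state = 0, cells = (\<lambda>i n. if i = 0 \<and> n < m then 1 else 0), head = (\<lambda>_. 0)(0 := k)\<rparr>"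
  have "(step C P X)\<^sup>*\<^sup>* (initial_config m) (?c k)" if "k \<le> m" for k
    using that
  proof (induction k)
    case 0
    then show ?case by (simp add: initial_config_def fun_upd_idem_iff)
  next
    case (Suc k)
    have "step C P X (?c k) (?c (Suc k))"
      by (rule stepI[where i=0 and \<delta>="[(1, 1, Right, 0), (0, 0, Stay, 1)]" and d=Right and s=1 and q=0])
         (use assms Suc in \<open>auto simp: scanned_def fun_eq_iff\<close>)
    then show ?case using Suc by (meson Suc_leD rtranclp.rtrancl_into_rtrancl)
  qed
  moreover have "step C P X (?c m) (reg_config ((\<lambda>_. 0)(0 := m)) 1)"
    by (rule stepI[where i=0 and \<delta>="[(1, 1, Right, 0), (0, 0, Stay, 1)]" and d=Stay and s=0 and q=1])
       (use assms in \<open>auto simp: scanned_def fun_eq_iff reg_config_def\<close>)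
  ultimately show ?thesis by (meson order_refl rtranclp.rtrancl_into_rtrancl)
qed

text \<open>Constructing a program is hereby reduced to the computability of five functions on
  numbers. Divergence is stated with checkpoints \<open>S\<close>, so that several iterations may be
  treated as one.\<close>

theorem driver_program:
  assumes comp: "computable start" "computable ask" "computable prog" "computable inp"
    "computable (\<lambda>z. upd (fst_of z) (fst_of (snd_of z)) (snd_of (snd_of z)))"
  obtains e where
    "\<And>X m x. (driver_step ask prog inp upd X)\<^sup>*\<^sup>* (start m) x \<Longrightarrow> x < 2 \<Longrightarrow> ((e, m, X), Conv x) \<in> I_infty"
    "\<And>X m S. start m \<in> S \<Longrightarrow> (\<And>x. x \<in> S \<Longrightarrow> \<exists>y\<in>S. (driver_step ask prog inp upd X)\<^sup>+\<^sup>+ x y) \<Longrightarrow>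
      ((e, m, X), Div) \<in> I_infty"
proof -
  have "computable (\<lambda>x. x - 1)" by (intro computable_intros)
  with comp obtain c0 c1 c2 c3 c4 c5 where
    "computes c0 start" "computes c1 ask" "computes c2 prog" "computes c3 inp" "computes c5 (\<lambda>x. x - 1)"
    "computes c4 (\<lambda>z. upd (fst_of z) (fst_of (snd_of z)) (snd_of (snd_of z)))"
    unfolding computable_def by metis
  note c = this[THEN computesD]
  \<comment> \<open>Register 0 holds \<open>x\<close>; registers 3, 4, 5 receive the oracle question
    and the program and input to be queried, registers 1 and 2 the two answers.\<close>
  define body where "body =
    (Loop 1 Skip ;; Copy_reg 0 3 4 ;; c1 3) ;; (Copy_reg 0 4 5 ;; c2 4) ;; (Copy_reg 0 5 6 ;; c3 5) ;;
    (Oracle 3 1 ;; Query 4 5 2) ;; (Loop 3 Skip ;; Loop 4 Skip ;; Loop 5 Skip) ;;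
    (Pair_regs 1 ;; Pair_regs 0 ;; c4 0) ;; (Copy_reg 0 1 2 ;; c5 1)"
  define prologue where "prologue = c0 0 ;; Copy_reg 0 1 2 ;; c5 1"
  \<comment> \<open>Register 1 is the loop counter: the value \<open>x - 1\<close> is zero exactly
    if \<open>x < 2\<close>.\<close>
  let ?regs = "\<lambda>x. (\<lambda>_. 0)(0 := x, 1 := x - 1)"
  have prologue: "exec C X prologue ((\<lambda>_. 0)(0 := m)) (?regs (start m))" for C X m
    unfolding prologue_def
    by (intro exec_Seq[OF c(1)[OF _ refl] exec_Seq[OF exec_Copy_reg[OF _ _ refl] c(5)]])
       (auto simp: fun_eq_iff)
  have body: "exec I_infty X body ((?regs x)(1 := ?regs x 1 - 1)) (?regs y)"
    if "driver_step ask prog inp upd X x y" for X x y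
  proof -
    from that obtain res where res: "((prog x, inp x, X), res) \<in> I_infty"
      and y: "y = upd x (of_bool (X (ask x))) (of_bool (res \<noteq> Div))"
      by (auto simp: driver_step_def)
    let ?bit = "of_bool (X (ask x))" and ?bit' = "of_bool (res \<noteq> Div)"
    show ?thesis
      unfolding body_def
    proof (intro exec_Seq)
      show "exec I_infty X (Loop 1 Skip) ((?regs x)(1 := ?regs x 1 - 1)) ((\<lambda>_. 0)(0 := x))"
        by (intro exec_Clear) auto
      show "exec I_infty X (Copy_reg 0 3 4) ((\<lambda>_. 0)(0 := x)) ((\<lambda>_. 0)(0 := x, 3 := x))"
        by (intro exec_Copy_reg) auto
      show "exec I_infty X (c1 3) ((\<lambda>_. 0)(0 := x, 3 := x)) ((\<lambda>_. 0)(0 := x, 3 := ask x))"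
        by (intro c(2)) auto
      show "exec I_infty X (Copy_reg 0 4 5) ((\<lambda>_. 0)(0 := x, 3 := ask x))
          ((\<lambda>_. 0)(0 := x, 3 := ask x, 4 := x))"
        by (intro exec_Copy_reg) auto
      show "exec I_infty X (c2 4) ((\<lambda>_. 0)(0 := x, 3 := ask x, 4 := x))
          ((\<lambda>_. 0)(0 := x, 3 := ask x, 4 := prog x))"
        by (intro c(3)) auto
      show "exec I_infty X (Copy_reg 0 5 6) ((\<lambda>_. 0)(0 := x, 3 := ask x, 4 := prog x))
          ((\<lambda>_. 0)(0 := x, 3 := ask x, 4 := prog x, 5 := x))"
        by (intro exec_Copy_reg) auto
      let ?R = "(\<lambda>_. 0)(0 := x, 3 := ask x, 4 := prog x, 5 := inp x)"
      show "exec I_infty X (c3 5) ((\<lambda>_. 0)(0 := x, 3 := ask x, 4 := prog x, 5 := x)) ?R"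
        by (intro c(4)) auto
      show "exec I_infty X (Oracle 3 1) ?R (?R(1 := ?bit))"
        using exec_Oracle[of I_infty X 3 1 ?R] by simp
      show "exec I_infty X (Query 4 5 2) (?R(1 := ?bit)) (?R(1 := ?bit, 2 := ?bit'))"
        using exec_Query[of "?R(1 := ?bit)" 4 5 X res I_infty 2] res by simp
      show "exec I_infty X (Loop 3 Skip) (?R(1 := ?bit, 2 := ?bit'))
          ((\<lambda>_. 0)(0 := x, 4 := prog x, 5 := inp x, 1 := ?bit, 2 := ?bit'))"
        by (intro exec_Clear) (simp add: fun_eq_iff)
      show "exec I_infty X (Loop 4 Skip) ((\<lambda>_. 0)(0 := x, 4 := prog x, 5 := inp x, 1 := ?bit, 2 := ?bit'))
          ((\<lambda>_. 0)(0 := x, 5 := inp x, 1 := ?bit, 2 := ?bit'))"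
        by (intro exec_Clear) (simp add: fun_eq_iff)
      show "exec I_infty X (Loop 5 Skip) ((\<lambda>_. 0)(0 := x, 5 := inp x, 1 := ?bit, 2 := ?bit'))
          ((\<lambda>_. 0)(0 := x, 1 := ?bit, 2 := ?bit'))"
        by (intro exec_Clear) (simp add: fun_eq_iff)
      show "exec I_infty X (Pair_regs 1) ((\<lambda>_. 0)(0 := x, 1 := ?bit, 2 := ?bit'))
          ((\<lambda>_. 0)(0 := x, 1 := pair ?bit ?bit'))"
        by (intro exec_Pair_regs) (simp_all add: fun_eq_iff pair_def)
      show "exec I_infty X (Pair_regs 0) ((\<lambda>_. 0)(0 := x, 1 := pair ?bit ?bit'))
          ((\<lambda>_. 0)(0 := pair x (pair ?bit ?bit')))"
        by (intro exec_Pair_regs) (simp_all add: fun_eq_iff pair_def)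
      show "exec I_infty X (c4 0) ((\<lambda>_. 0)(0 := pair x (pair ?bit ?bit'))) ((\<lambda>_. 0)(0 := y))"
        by (intro c(6)) (simp_all add: y)
      show "exec I_infty X (Copy_reg 0 1 2) ((\<lambda>_. 0)(0 := y)) ((\<lambda>_. 0)(0 := y, 1 := y))"
        by (intro exec_Copy_reg) auto
      show "exec I_infty X (c5 1) ((\<lambda>_. 0)(0 := y, 1 := y)) (?regs y)"
        by (intro c(5)) auto
    qed
  qed
  define P where "P = Act 0 [(1, 1, Right, 0), (0, 0, Stay, 1)] # code (prologue ;; Loop 1 body) 1"
  obtain e where e: "program_of e = P" using surj_program_of by (metis surj_def)
  let ?p = "1 + len prologue"
  have at: "code_at P 0 [Act 0 [(1, 1, Right, 0), (0, 0, Stay, 1)]]"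
      "code_at P 1 (code prologue 1)" "code_at P ?p (code (Loop 1 body) ?p)"
    using code_at_self[of "[Act 0 [(1, 1, Right, 0), (0, 0, Stay, 1)]]" "code (prologue ;; Loop 1 body) 1"]
    by (simp_all only: P_def code_at_append code.simps) (simp_all add: P_def)
  have init: "(step I_infty P X)\<^sup>*\<^sup>* (initial_config m) (reg_config (?regs (start m)) ?p)" for X m
    using load_input[OF at(1)] execD[OF prologue at(2)] by (meson rtranclp_trans)
  have iter: "(step I_infty P X)\<^sup>+\<^sup>+ (reg_config (?regs x) ?p) (reg_config (?regs y) ?p)"
    if "driver_step ask prog inp upd X x y" for X x y
    using that by (intro Loop_iteration[OF at(3) _ body]) (auto simp: driver_step_def)
  show thesis
  proof (rule that[of e])
    fix X m x
    assume "(driver_step ask prog inp upd X)\<^sup>*\<^sup>* (start m) x" "x < 2"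
    from this(1) have "(step I_infty P X)\<^sup>*\<^sup>* (initial_config m) (reg_config (?regs x) ?p)"
    proof (induction rule: rtranclp_induct)
      case base
      show ?case by (rule init)
    next
      case (step y z)
      then show ?case using iter by (meson rtranclp_trans tranclp_into_rtranclp)
    qed
    moreover have "(step I_infty P X)\<^sup>+\<^sup>+ (reg_config (?regs x) ?p) (reg_config (?regs x) (?p + len body + 3))"
      using \<open>x < 2\<close> by (intro Loop_exit[OF at(3)]) auto
    ultimately have run: "(step I_infty P X)\<^sup>*\<^sup>* (initial_config m) (reg_config (?regs x) (?p + len body + 3))"
      by (meson rtranclp_trans tranclp_into_rtranclp)
    \<comment> \<open>The exit address is the length of \<open>P\<close>, a state without
      instruction.\<close>
    have "halted P (reg_config (?regs x) (?p + len body + 3))"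
      by (simp add: halted_def P_def)
    from I_op_converges[of I_infty e X m, unfolded e, OF run this]
    show "((e, m, X), Conv x) \<in> I_infty" unfolding I_infty_fixpoint by simp
  next
    fix X m S
    assume S: "start m \<in> S" "\<And>x. x \<in> S \<Longrightarrow> \<exists>y\<in>S. (driver_step ask prog inp upd X)\<^sup>+\<^sup>+ x y"
    have "(step I_infty P X)\<^sup>+\<^sup>+ (reg_config (?regs x) ?p) (reg_config (?regs y) ?p)"
      if "(driver_step ask prog inp upd X)\<^sup>+\<^sup>+ x y" for x y
      using that
    proof (induction rule: tranclp_induct)
      case (base y)
      then show ?case by (rule iter)
    next
      case (step y z)
      then show ?case using iter by (meson tranclp_trans)
    qed
    note loop = this
    let ?T = "{c. \<exists>x\<in>S. (step I_infty P X)\<^sup>*\<^sup>* c (reg_config (?regs x) ?p)}"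
    have "\<exists>f. f 0 = initial_config m \<and> (\<forall>n. step I_infty P X (f n) (f (Suc n)))"
    proof (rule infinite_run[of _ ?T])
      show "initial_config m \<in> ?T" using S(1) init by blast
      fix c assume "c \<in> ?T"
      then obtain x where "x \<in> S" "(step I_infty P X)\<^sup>*\<^sup>* c (reg_config (?regs x) ?p)" by blast
      moreover obtain y where "y \<in> S" "(driver_step ask prog inp upd X)\<^sup>+\<^sup>+ x y" using S(2) \<open>x \<in> S\<close> by blast
      ultimately have "(step I_infty P X)\<^sup>+\<^sup>+ c (reg_config (?regs y) ?p)"
        using loop by (meson rtranclp_tranclp_tranclp)
      then show "\<exists>d\<in>?T. (step I_infty P X)\<^sup>+\<^sup>+ c d" using \<open>y \<in> S\<close> by blast
    qed
    then obtain f where "f 0 = initial_config m" "\<And>n. step I_infty P X (f n) (f (Suc n))" by blast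
    from I_op_diverges[of f m I_infty e X, unfolded e, OF this]
    show "((e, m, X), Div) \<in> I_infty" unfolding I_infty_fixpoint .
  qed
qed

section \<open>Machine configurations coded by numbers\<close>

definition hd_of :: "nat \<Rightarrow> nat" where "hd_of L = fst_of (L - 1)"
definition tl_of :: "nat \<Rightarrow> nat" where "tl_of L = snd_of (L - 1)"

lemma hd_of_Suc_pair [simp]: "hd_of (Suc (pair x L)) = x"
  and tl_of_Suc_pair [simp]: "tl_of (Suc (pair x L)) = L"
  by (simp_all add: hd_of_def tl_of_def)

lemma computable_hd_of [computable_intros]: "computable f \<Longrightarrow> computable (\<lambda>x. hd_of (f x))"
  and computable_tl_of [computable_intros]: "computable f \<Longrightarrow> computable (\<lambda>x. tl_of (f x))"
  unfolding hd_of_def tl_of_def by (intro computable_intros; assumption)+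

lemma list_decode_Suc_pair: "list_decode (Suc (pair x L)) = x # list_decode L"
  by (simp add: pair_def)

lemma list_decode_Cons: "L \<noteq> 0 \<Longrightarrow> list_decode L = hd_of L # list_decode (tl_of L)"
  using list_decode_Suc_pair[of "hd_of L" "tl_of L"] by (simp add: hd_of_def tl_of_def)

lemma list_decode_eq_Nil [simp]: "list_decode L = [] \<longleftrightarrow> L = 0"
  using list_decode_Cons[of L] by (cases "L = 0") auto

text \<open>Thereby \<open>tl_of 0 = 0\<close>, matching \<open>tl [] = []\<close>, and taking too
  many tails does no harm.\<close>

lemma snd_of_0 [simp]: "snd_of 0 = 0"
  by (simp add: snd_of_def prod_decode_def prod_decode_aux.simps)

lemma list_decode_tl_of: "list_decode (tl_of L) = tl (list_decode L)"
  by (cases "L = 0") (simp_all add: list_decode_Cons, simp add: tl_of_def)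

lemma hd_of_eq: "L \<noteq> 0 \<Longrightarrow> hd_of L = hd (list_decode L)"
  by (simp add: list_decode_Cons)

lemma list_decode_drop: "list_decode ((tl_of ^^ n) L) = drop n (list_decode L)"
  by (induction n) (simp_all add: list_decode_tl_of tl_drop drop_Suc)

lemma fst_of_le: "fst_of z \<le> z"
  unfolding fst_of_def by (metis le_prod_encode_1 prod.collapse prod_decode_inverse)

lemma in_list_decode_less: "z \<in> set (list_decode L) \<Longrightarrow> z < L"
proof (induction L rule: list_decode.induct)
  case (2 n)
  obtain x y where n: "prod_decode n = (x, y)" by fastforce
  then have "n = prod_encode (x, y)" by (metis prod_decode_inverse)
  then have "x \<le> n" "y \<le> n" by (auto simp: le_prod_encode_1 le_prod_encode_2)
  moreover have "z = x \<or> z \<in> set (list_decode y)" using 2(2) n by simp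
  ultimately show ?case using 2(1)[OF n[symmetric]] by force
qed simp

lemma length_list_decode: "length (list_decode L) \<le> L"
proof (induction L rule: list_decode.induct)
  case (2 n)
  obtain x y where n: "prod_decode n = (x, y)" by fastforce
  then have "n = prod_encode (x, y)" by (metis prod_decode_inverse)
  then have "y \<le> n" by (auto simp: le_prod_encode_2)
  then show ?case using 2[OF n[symmetric]] n by simp
qed simp

text \<open>Search by bounded iteration: a list coded by \<open>L\<close> has at most
  \<open>L\<close> elements, and once an entry with key \<open>k\<close> comes first the list stays
  fixed.\<close>

definition seek :: "nat \<Rightarrow> nat \<Rightarrow> nat" where
  "seek k L = ((\<lambda>M. if fst_of (hd_of M) = k then M else tl_of M) ^^ L) L"

lemma computable_seek [computable_intros]:
  assumes "computable f" "computable g" shows "computable (\<lambda>x. seek (f x) (g x))"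
  unfolding seek_def by (intro computable_intros assms[THEN computable_comp])

lemma list_decode_seek: "list_decode (seek k L) = dropWhile (\<lambda>z. fst_of z \<noteq> k) (list_decode L)"
proof -
  let ?s = "\<lambda>M. if fst_of (hd_of M) = k then M else tl_of M"
  have "list_decode ((?s ^^ n) L) = dropWhile (\<lambda>z. fst_of z \<noteq> k) (list_decode L)"
    if "length (list_decode L) \<le> n" for n L
    using that
  proof (induction n arbitrary: L)
    case 0
    then show ?case by simp
  next
    case (Suc n)
    show ?case
    proof (cases "L = 0")
      case True
      have "(?s ^^ m) 0 = 0" for m by (induction m) (auto simp: tl_of_def)
      then show ?thesis using True by (simp del: funpow.simps)
    next
      case False
      have "(?s ^^ m) L = L" if "fst_of (hd_of L) = k" for m
        using that by (induction m) auto
      then show ?thesis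
        using Suc(1)[of "tl_of L"] Suc(2) list_decode_Cons[OF False]
        by (cases "fst_of (hd_of L) = k") (simp_all add: funpow_Suc_right del: funpow.simps)
    qed
  qed
  from this[OF length_list_decode] show ?thesis unfolding seek_def .
qed

lemma map_of_dropWhile:
  "map_of (map (\<lambda>z. (f z, g z)) xs) k = (case dropWhile (\<lambda>z. f z \<noteq> k) xs of [] \<Rightarrow> None | z # _ \<Rightarrow> Some (g z))"
  by (induction xs) auto

lemma map_of_seek:
  "map_of (map (\<lambda>z. (fst_of z, g z)) (list_decode L)) k =
    (if seek k L = 0 then None else Some (g (hd_of (seek k L))))"
  unfolding map_of_dropWhile list_decode_seek[symmetric]
  by (cases "seek k L = 0") (simp_all add: list_decode_Cons)

definition lookup :: "nat \<Rightarrow> nat \<Rightarrow> nat \<Rightarrow> nat" where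
  "lookup d k L = (if seek k L = 0 then d else snd_of (hd_of (seek k L)))"

lemma computable_lookup [computable_intros]:
  "computable f \<Longrightarrow> computable g \<Longrightarrow> computable h \<Longrightarrow> computable (\<lambda>x. lookup (f x) (g x) (h x))"
  unfolding lookup_def by (intro computable_intros; assumption)

lemma lookup_eq:
  "lookup d k L = (case map_of (map (\<lambda>z. (fst_of z, snd_of z)) (list_decode L)) k of None \<Rightarrow> d | Some v \<Rightarrow> v)"
  unfolding lookup_def map_of_seek by simp

lemma lookup_Cons: "lookup d k (Suc (pair (pair k' v) L)) = (if k = k' then v else lookup d k L)"
  unfolding lookup_eq list_decode_Suc_pair by auto

lemma lookup_0: "lookup d k 0 = d"
  unfolding lookup_eq by simp

lemma lookup_large: "L \<le> k \<Longrightarrow> lookup d k L = d"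
proof -
  assume "L \<le> k"
  then have "map_of (map (\<lambda>z. (fst_of z, snd_of z)) (list_decode L)) k = None"
    unfolding map_of_eq_None_iff
    by (auto dest!: in_list_decode_less) (meson fst_of_le leD order_trans)
  then show ?thesis by (simp add: lookup_eq)
qed

section \<open>Tapes as association lists\<close>

text \<open>
  The tapes of a simulated machine are an association list, most recent entry first: the key
  \<open>(i, 0)\<close> gives the position of head \<open>i\<close>, and \<open>(i, n + 1)\<close> the content of cell \<open>n\<close> of tape \<open>i\<close>. Since all
  keys in a list \<open>L\<close> are below \<open>L\<close>, cell \<open>m + L\<close> is blank, which bounds the search in \<open>value_of\<close>.
\<close>

definition head_of :: "nat \<Rightarrow> nat \<Rightarrow> nat" where
  "head_of L i = lookup 0 (pair i 0) L"

definition cell_of :: "nat \<Rightarrow> nat \<Rightarrow> nat \<Rightarrow> nat \<Rightarrow> nat" where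
  "cell_of m L i n = lookup (if i = 0 \<and> n < m then 1 else 0) (pair i (Suc n)) L"

definition value_of :: "nat \<Rightarrow> nat \<Rightarrow> nat \<Rightarrow> nat" where
  "value_of m L i = ((\<lambda>n. if cell_of m L i n = 1 then Suc n else n) ^^ (m + L)) 0"

lemma computable_head_of [computable_intros]:
  "computable f \<Longrightarrow> computable g \<Longrightarrow> computable (\<lambda>x. head_of (f x) (g x))"
  unfolding head_of_def by (intro computable_intros; assumption)

lemma computable_cell_of [computable_intros]:
  "computable f \<Longrightarrow> computable g \<Longrightarrow> computable h \<Longrightarrow> computable k \<Longrightarrow>
    computable (\<lambda>x. cell_of (f x) (g x) (h x) (k x))"
  unfolding cell_of_def by (intro computable_intros; assumption)

lemma computable_value_of [computable_intros]:
  assumes "computable f" "computable g" "computable h"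
  shows "computable (\<lambda>x. value_of (f x) (g x) (h x))"
  unfolding value_of_def by (intro computable_intros assms[THEN computable_comp])

text \<open>\<open>s\<close> pairs the state with the tape list. The input \<open>m\<close> never
  enters that list; it shows as the default content of tape 0.\<close>

definition sim_config :: "nat \<Rightarrow> nat \<Rightarrow> config" where
  "sim_config m s = \<lparr>state = fst_of s, cells = cell_of m (snd_of s), head = head_of (snd_of s)\<rparr>"

lemma sim_config_simps [simp]:
  "state (sim_config m s) = fst_of s" "cells (sim_config m s) = cell_of m (snd_of s)"
  "head (sim_config m s) = head_of (snd_of s)"
  by (simp_all add: sim_config_def)

lemma sim_config_initial: "sim_config m (pair 0 0) = initial_config m"
  by (auto simp: sim_config_def initial_config_def cell_of_def head_of_def lookup_0 fun_eq_iff)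

lemma sim_config_state: "sim_config m s\<lparr>state := q\<rparr> = sim_config m (pair q (snd_of s))"
  by (simp add: sim_config_def)

text \<open>Bounded minimization: the counter stops at the first number that fails \<open>Q\<close>,
  and \<open>B\<close> rounds suffice to get there.\<close>

lemma funpow_Least:
  fixes Q :: "nat \<Rightarrow> bool"
  assumes "\<not> Q B"
  shows "((\<lambda>n. if Q n then Suc n else n) ^^ B) 0 = (LEAST n. \<not> Q n)"
proof -
  let ?f = "\<lambda>n. if Q n then Suc n else n" and ?l = "LEAST n. \<not> Q n"
  have "(?f ^^ k) 0 = min k ?l" for k
  proof (induction k)
    case (Suc k)
    have "Q k" if "k < ?l" using not_less_Least[OF that] by simp
    moreover have "\<not> Q ?l" using assms by (rule LeastI)
    ultimately show ?case using Suc by (auto simp: min_def not_le Suc_le_eq)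
  qed simp
  moreover have "?l \<le> B" using assms by (rule Least_le)
  ultimately show ?thesis by simp
qed

lemma tape_value_sim_config [simp]: "tape_value (sim_config m s) i = value_of m (snd_of s) i"
proof -
  have "pair i (Suc (m + snd_of s)) \<ge> Suc (m + snd_of s)"
    unfolding pair_def by (rule le_prod_encode_2)
  then have "cell_of m (snd_of s) i (m + snd_of s) = 0"
    unfolding cell_of_def by (subst lookup_large) auto
  then show ?thesis
    unfolding tape_value_def value_of_def by (subst funpow_Least) auto
qed

text \<open>New entries shadow older ones with the same key. The cell is addressed by the head
  position before the move.\<close>

definition write_move :: "nat \<Rightarrow> nat \<Rightarrow> nat \<Rightarrow> nat \<Rightarrow> nat" where
  "write_move i v d L = Suc (pair (pair (pair i 0)
      (if d mod 3 = 0 then head_of L i - 1 else if d mod 3 = 1 then head_of L i else Suc (head_of L i)))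
    (Suc (pair (pair (pair i (Suc (head_of L i))) v) L)))"

lemma computable_write_move [computable_intros]:
  "computable f \<Longrightarrow> computable g \<Longrightarrow> computable h \<Longrightarrow> computable k \<Longrightarrow>
    computable (\<lambda>x. write_move (f x) (g x) (h x) (k x))"
  unfolding write_move_def by (intro computable_intros; assumption)

lemma pair_eq_iff [simp]: "pair x y = pair x' y' \<longleftrightarrow> x = x' \<and> y = y'"
  by (auto simp: pair_def)

lemma sim_config_write_move:
  "sim_config m (pair q (write_move i v d L)) =
    \<lparr>state = q, cells = (cell_of m L)(i := (cell_of m L i)(head_of L i := v)),
     head = (head_of L)(i := move_head (decode_move d) (head_of L i))\<rparr>"
  by (auto simp: sim_config_def write_move_def cell_of_def head_of_def lookup_Cons fun_eq_iff)

section \<open>The comparison program\<close>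

text \<open>
  Input of the comparison program: \<open>w\<close> is its own index, which is passed around so that the
  recursion theorem is not needed. In mode \<open>0\<close> it simulates \<open>\<gamma>\<close> with half \<open>b\<close> of the oracle; in mode \<open>1\<close>
  it is \<open>K(\<gamma>, \<delta>)\<close>, with half \<open>b\<close> of the oracle for \<open>\<gamma>\<close> and half \<open>1 - b\<close> for \<open>\<delta>\<close>.
\<close>

definition arg :: "nat \<Rightarrow> nat \<Rightarrow> nat \<Rightarrow> nat \<Rightarrow> nat \<Rightarrow> nat" where
  "arg w mode b \<gamma> \<delta> = pair w (pair mode (pair b (pair \<gamma> \<delta>)))"

text \<open>
  In mode \<open>1\<close>, phase \<open>p = 1\<close> records that the pending query has already been compared with the rival \<open>\<delta>\<close>.
\<close>

definition sim_state :: "nat \<Rightarrow> nat \<Rightarrow> nat \<Rightarrow> nat" where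
  "sim_state a p s = Suc (Suc (pair a (pair p s)))"

text \<open>Subtracting 2 undoes the two \<open>Suc\<close> of \<open>sim_state\<close>, which keep
  running states out of the range \<open>x < 2\<close> where a driver ends.\<close>

definition arg_of :: "nat \<Rightarrow> nat" where "arg_of x = fst_of (x - 2)"
definition index_of :: "nat \<Rightarrow> nat" where "index_of x = fst_of (arg_of x)"
definition mode_of :: "nat \<Rightarrow> nat" where "mode_of x = fst_of (snd_of (arg_of x))"
definition side_of :: "nat \<Rightarrow> nat" where "side_of x = fst_of (snd_of (snd_of (arg_of x)))"
definition code_of :: "nat \<Rightarrow> nat" where "code_of x = fst_of (fst_of (snd_of (snd_of (snd_of (arg_of x)))))"
definition input_of :: "nat \<Rightarrow> nat" where "input_of x = snd_of (fst_of (snd_of (snd_of (snd_of (arg_of x)))))"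
definition rival_of :: "nat \<Rightarrow> nat" where "rival_of x = snd_of (snd_of (snd_of (snd_of (arg_of x))))"
definition phase_of :: "nat \<Rightarrow> nat" where "phase_of x = fst_of (snd_of (x - 2))"
definition machine_of :: "nat \<Rightarrow> nat" where "machine_of x = snd_of (snd_of (x - 2))"
definition tapes_of :: "nat \<Rightarrow> nat" where "tapes_of x = snd_of (machine_of x)"
text \<open>The program from the current instruction on; the value 0 signals a state beyond its
  end.\<close>

definition rest_of :: "nat \<Rightarrow> nat" where "rest_of x = (tl_of ^^ fst_of (machine_of x)) (code_of x)"
definition op_of :: "nat \<Rightarrow> nat" where "op_of x = hd_of (rest_of x) mod 3"
definition tape_of :: "nat \<Rightarrow> nat" where "tape_of x = fst_of (hd_of (rest_of x) div 3)"
definition operand_of :: "nat \<Rightarrow> nat" where "operand_of x = snd_of (hd_of (rest_of x) div 3)"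
definition entry_of :: "nat \<Rightarrow> nat" where
  "entry_of x = seek (cell_of (input_of x) (tapes_of x) (tape_of x) (head_of (tapes_of x) (tape_of x))) (operand_of x)"

lemmas accessor_defs = arg_of_def index_of_def mode_of_def side_of_def code_of_def input_of_def
  rival_of_def phase_of_def machine_of_def tapes_of_def rest_of_def op_of_def tape_of_def
  operand_of_def entry_of_def

lemma computable_accessors [computable_intros]:
  assumes f: "computable f"
  shows "computable (\<lambda>x. arg_of (f x))" "computable (\<lambda>x. index_of (f x))" "computable (\<lambda>x. mode_of (f x))"
    "computable (\<lambda>x. side_of (f x))" "computable (\<lambda>x. code_of (f x))" "computable (\<lambda>x. input_of (f x))"
    "computable (\<lambda>x. rival_of (f x))" "computable (\<lambda>x. phase_of (f x))" "computable (\<lambda>x. machine_of (f x))"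
    "computable (\<lambda>x. tapes_of (f x))" "computable (\<lambda>x. rest_of (f x))" "computable (\<lambda>x. op_of (f x))"
    "computable (\<lambda>x. tape_of (f x))" "computable (\<lambda>x. operand_of (f x))" "computable (\<lambda>x. entry_of (f x))"
  unfolding accessor_defs by (intro computable_intros f)+

definition set_machine :: "nat \<Rightarrow> nat \<Rightarrow> nat \<Rightarrow> nat" where
  "set_machine x p s = sim_state (arg_of x) p s"

lemma computable_set_machine [computable_intros]:
  "computable f \<Longrightarrow> computable g \<Longrightarrow> computable h \<Longrightarrow> computable (\<lambda>x. set_machine (f x) (g x) (h x))"
  unfolding set_machine_def sim_state_def by (intro computable_intros; assumption)

definition comparing :: "nat \<Rightarrow> bool" where
  "comparing x \<longleftrightarrow> mode_of x \<noteq> 0 \<and> phase_of x = 0"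

text \<open>If the simulated machine has halted, 0 ends the driver in mode 0, while the unchanged
  \<open>x\<close> makes it loop in mode 1. A comparison that diverges ends the driver; one that
  converges only sets phase 1, so that the next round makes the query itself.\<close>

definition next_state :: "nat \<Rightarrow> nat \<Rightarrow> nat \<Rightarrow> nat" where
  "next_state x b b' =
    (if rest_of x = 0 \<or> (op_of x = 0 \<and> entry_of x = 0) then if mode_of x = 0 then 0 else x
     else if op_of x = 0 then
       set_machine x 0 (pair (snd_of (snd_of (snd_of (hd_of (entry_of x)))))
         (write_move (tape_of x) (fst_of (snd_of (hd_of (entry_of x))))
           (fst_of (snd_of (snd_of (hd_of (entry_of x))))) (tapes_of x)))
     else if op_of x = 1 then
       set_machine x 0 (pair (if b = 0 then snd_of (operand_of x) else fst_of (operand_of x)) (tapes_of x))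
     else if comparing x then if b' = 0 then 0 else set_machine x 1 (machine_of x)
     else set_machine x 0 (pair (if b' = 0 then snd_of (snd_of (operand_of x))
       else fst_of (snd_of (operand_of x))) (tapes_of x)))"

text \<open>Number \<open>n\<close> of half \<open>b\<close> stands at position
  \<open>n + n + b\<close> of a join.\<close>

definition oracle_question :: "nat \<Rightarrow> nat" where
  "oracle_question x = value_of (input_of x) (tapes_of x) (tape_of x)
     + value_of (input_of x) (tapes_of x) (tape_of x) + side_of x"

definition querying :: "nat \<Rightarrow> bool" where
  "querying x \<longleftrightarrow> \<not> rest_of x = 0 \<and> \<not> op_of x = 0 \<and> \<not> op_of x = 1"

text \<open>
  When the simulated machine makes no query, the driver asks about program \<open>0\<close>, the empty program,
  on input \<open>0\<close>.
\<close>

definition query_index :: "nat \<Rightarrow> nat" where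
  "query_index x = (if querying x then index_of x else 0)"

definition queried :: "nat \<Rightarrow> nat" where
  "queried x = pair (value_of (input_of x) (tapes_of x) (tape_of x))
     (value_of (input_of x) (tapes_of x) (fst_of (operand_of x)))"

text \<open>A comparison exchanges the roles, as in \<open>K(\<delta>, \<gamma>')\<close>: the
  rival, with the other half of the oracle, is run against the pending query. The query itself is
  put as a simulation in mode 0.\<close>

definition query_input :: "nat \<Rightarrow> nat" where
  "query_input x = (if querying x then
     if comparing x then arg (index_of x) 1 (1 - side_of x) (rival_of x) (queried x)
     else arg (index_of x) 0 (side_of x) (queried x) 0
   else 0)"

lemma decidable_comparing: "decidable comparing"
  unfolding comparing_def by (intro computable_intros)

lemma decidable_querying: "decidable querying"
  unfolding querying_def by (intro computable_intros)

lemma decidable_comp: "decidable Q \<Longrightarrow> computable f \<Longrightarrow> decidable (\<lambda>x. Q (f x))"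
  unfolding decidable_def by (rule computable_comp)

lemma computable_query_index: "computable query_index"
  unfolding query_index_def by (intro computable_intros decidable_querying)

lemma computable_query_input: "computable query_input"
  unfolding query_input_def arg_def queried_def
  by (intro computable_intros decidable_querying decidable_comparing)

lemma computable_oracle_question: "computable oracle_question"
  unfolding oracle_question_def by (intro computable_intros)

lemma computable_next_state:
  "computable (\<lambda>z. next_state (fst_of z) (fst_of (snd_of z)) (snd_of (snd_of z)))"
  unfolding next_state_def
  by (intro computable_intros decidable_comp[OF decidable_comparing])

abbreviation sim_step :: "oracle_set \<Rightarrow> nat \<Rightarrow> nat \<Rightarrow> bool" where
  "sim_step \<equiv> driver_step oracle_question query_index query_input next_state"

definition start :: "nat \<Rightarrow> nat" where
  "start m = sim_state m 0 (pair 0 0)"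

text \<open>The guarantees of \<open>driver_program\<close> for the halting value 0. They hold for
  all inputs, including those that carry \<open>w\<close> as the index to be queried.\<close>

definition simulator :: "nat \<Rightarrow> bool" where
  "simulator w \<longleftrightarrow>
    (\<forall>X m. (sim_step X)\<^sup>*\<^sup>* (start m) 0 \<longrightarrow> ((w, m, X), Conv 0) \<in> I_infty) \<and>
    (\<forall>X m S. start m \<in> S \<longrightarrow> (\<forall>x\<in>S. \<exists>y\<in>S. (sim_step X)\<^sup>+\<^sup>+ x y) \<longrightarrow> ((w, m, X), Div) \<in> I_infty)"

lemma simulator_exists: "\<exists>w. simulator w"
proof -
  have "computable start"
    unfolding start_def sim_state_def by (intro computable_intros)
  then obtain w where
    "\<And>X m x. (sim_step X)\<^sup>*\<^sup>* (start m) x \<Longrightarrow> x < 2 \<Longrightarrow> ((w, m, X), Conv x) \<in> I_infty"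
    "\<And>X m S. start m \<in> S \<Longrightarrow> (\<And>x. x \<in> S \<Longrightarrow> \<exists>y\<in>S. (sim_step X)\<^sup>+\<^sup>+ x y) \<Longrightarrow> ((w, m, X), Div) \<in> I_infty"
    by (rule driver_program[OF _ computable_oracle_question computable_query_index
          computable_query_input computable_next_state]) blast
  then show ?thesis unfolding simulator_def by (intro exI[of _ w]) auto
qed

section \<open>Correctness of the simulation\<close>

lemma accessors_sim_state [simp]:
  fixes w mode b e m \<delta> p s :: nat
  defines "x \<equiv> sim_state (arg w mode b (pair e m) \<delta>) p s"
  shows "arg_of x = arg w mode b (pair e m) \<delta>" "index_of x = w" "mode_of x = mode" "side_of x = b"
    "code_of x = e" "input_of x = m" "rival_of x = \<delta>" "phase_of x = p" "machine_of x = s"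
    "tapes_of x = snd_of s" "rest_of x = (tl_of ^^ fst_of s) e"
  by (simp_all add: accessor_defs x_def sim_state_def arg_def)

lemma decode_instr_eq:
  "decode_instr n =
    (if n mod 3 = 0 then Act (fst_of (n div 3))
       (map (\<lambda>z. (fst_of z, fst_of (snd_of z), decode_move (fst_of (snd_of (snd_of z))), snd_of (snd_of (snd_of z))))
         (list_decode (snd_of (n div 3))))
     else if n mod 3 = 1 then Oracle_Query (fst_of (n div 3)) (fst_of (snd_of (n div 3))) (snd_of (snd_of (n div 3)))
     else Feedback_Query (fst_of (n div 3)) (fst_of (snd_of (n div 3)))
       (fst_of (snd_of (snd_of (n div 3)))) (snd_of (snd_of (snd_of (n div 3)))))"
  by (simp add: Let_def case_prod_beta fst_of_def snd_of_def del: decode_move.simps)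

lemma rest_of_program:
  "(tl_of ^^ q) e = 0 \<longleftrightarrow> length (program_of e) \<le> q"
  "(tl_of ^^ q) e \<noteq> 0 \<Longrightarrow> program_of e ! q = decode_instr (hd_of ((tl_of ^^ q) e))"
proof -
  show *: "(tl_of ^^ q) e = 0 \<longleftrightarrow> length (program_of e) \<le> q"
    unfolding list_decode_eq_Nil[symmetric] list_decode_drop by (simp add: program_of_def)
  assume "(tl_of ^^ q) e \<noteq> 0"
  with * show "program_of e ! q = decode_instr (hd_of ((tl_of ^^ q) e))"
    by (simp add: hd_of_eq list_decode_drop hd_drop_conv_nth program_of_def del: decode_instr.simps)
qed

definition half :: "oracle_set \<Rightarrow> nat \<Rightarrow> oracle_set" where
  "half X b n = X (n + n + b)"

text \<open>The empty program halts at once. This gives rounds without a simulated query a defined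
  answer.\<close>

lemma trivial_query: "((0, 0, X), Conv 0) \<in> I_infty"
proof -
  have "((0, 0, X), Conv (tape_value (initial_config 0) 0)) \<in> I_op I_infty"
    by (intro I_op_converges) (auto simp: halted_def program_of_def)
  then show ?thesis by (simp add: I_infty_fixpoint tape_value_def initial_config_def)
qed

lemma idle_step:
  "\<not> querying x \<Longrightarrow> 2 \<le> x \<Longrightarrow> sim_step X x (next_state x (of_bool (X (oracle_question x))) 1)"
  unfolding driver_step_def query_index_def query_input_def
  by (auto intro!: exI[of _ "Conv 0"] trivial_query)

lemma sim_state_ge [simp]: "2 \<le> sim_state a p s" "sim_state a p s \<noteq> 0"
  by (simp_all add: sim_state_def)

lemma simulator_diverges:
  "simulator w \<Longrightarrow> start m \<in> S \<Longrightarrow> (\<And>x. x \<in> S \<Longrightarrow> \<exists>y\<in>S. (sim_step X)\<^sup>+\<^sup>+ x y) \<Longrightarrow>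
    ((w, m, X), Div) \<in> I_infty"
  unfolding simulator_def by simp

text \<open>\<open>D\<close> holds the answers on which the simulated run relies. By
  \<open>answered\<close>, simulated queries get answers of the same kind; by
  \<open>compared\<close>, the test preceding such a query in mode 1 lets it pass.\<close>

context
  fixes w mode b e m \<delta> :: nat and X :: oracle_set and D :: "(comp \<times> outcome) set"
  assumes simulator: "simulator w"
    and answered: "\<And>e' m' r. ((e', m', half X b), r) \<in> D \<Longrightarrow>
      \<exists>r'. ((w, arg w 0 b (pair e' m') 0, X), r') \<in> I_infty \<and> (r' = Div \<longleftrightarrow> r = Div)"
    and compared: "\<And>e' m' r. mode \<noteq> 0 \<Longrightarrow> ((e', m', half X b), r) \<in> D \<Longrightarrow>
      \<exists>k. ((w, arg w 1 (1 - b) \<delta> (pair e' m'), X), Conv k) \<in> I_infty"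
begin

abbreviation (input) P where "P \<equiv> program_of e"
abbreviation (input) Z where "Z \<equiv> half X b"
abbreviation (input) st where "st p s \<equiv> sim_state (arg w mode b (pair e m) \<delta>) p s"

lemma sim_length: "rest_of (st p s) = 0 \<longleftrightarrow> length P \<le> fst_of s"
  by (simp add: rest_of_program)

lemma sim_instr:
  assumes "fst_of s < length P"
  shows "P ! fst_of s =
    (if op_of (st p s) = 0 then Act (tape_of (st p s))
       (map (\<lambda>z. (fst_of z, fst_of (snd_of z), decode_move (fst_of (snd_of (snd_of z))), snd_of (snd_of (snd_of z))))
         (list_decode (operand_of (st p s))))
     else if op_of (st p s) = 1 then
       Oracle_Query (tape_of (st p s)) (fst_of (operand_of (st p s))) (snd_of (operand_of (st p s)))
     else Feedback_Query (tape_of (st p s)) (fst_of (operand_of (st p s)))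
       (fst_of (snd_of (operand_of (st p s)))) (snd_of (snd_of (operand_of (st p s)))))"
proof -
  have "(tl_of ^^ fst_of s) e \<noteq> 0" using assms by (simp add: rest_of_program)
  then show ?thesis
    unfolding rest_of_program(2)[OF \<open>(tl_of ^^ fst_of s) e \<noteq> 0\<close>] decode_instr_eq
    by (simp add: op_of_def tape_of_def operand_of_def)
qed

lemma sim_transition:
  "map_of (map (\<lambda>z. (fst_of z, fst_of (snd_of z), decode_move (fst_of (snd_of (snd_of z))), snd_of (snd_of (snd_of z))))
       (list_decode (operand_of (st p s)))) (scanned (sim_config m s) (tape_of (st p s))) =
    (if entry_of (st p s) = 0 then None
     else Some (fst_of (snd_of (hd_of (entry_of (st p s)))),
       decode_move (fst_of (snd_of (snd_of (hd_of (entry_of (st p s)))))),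
       snd_of (snd_of (snd_of (hd_of (entry_of (st p s)))))))"
  unfolding map_of_seek by (simp add: entry_of_def scanned_def)

lemma sim_halted:
  "halted P (sim_config m s) \<longleftrightarrow>
    rest_of (st p s) = 0 \<or> (op_of (st p s) = 0 \<and> entry_of (st p s) = 0)"
proof (cases "length P \<le> fst_of s")
  case True
  then show ?thesis using sim_length[of p s] by (simp add: halted_def)
next
  case False
  then have *: "rest_of (st p s) \<noteq> 0" "fst_of s < length P" using sim_length[of p s] by auto
  show ?thesis
    using * sim_instr[OF *(2), of p] sim_transition[of p s]
    by (cases "op_of (st p s) = 0"; cases "op_of (st p s) = 1") (simp_all add: halted_def)
qed

lemma sim_step_halted:
  assumes "halted P (sim_config m s)"
  shows "sim_step X (st p s) (if mode = 0 then 0 else st p s)"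
proof -
  have *: "rest_of (st p s) = 0 \<or> (op_of (st p s) = 0 \<and> entry_of (st p s) = 0)"
    using assms sim_halted by blast
  then have "next_state (st p s) y z = (if mode = 0 then 0 else st p s)" for y z
    unfolding next_state_def by (simp del: accessors_sim_state(11))
  moreover have "\<not> querying (st p s)" using * unfolding querying_def by auto
  ultimately show ?thesis using idle_step[of "st p s" X] by simp
qed

lemma sim_step_query:
  assumes "fst_of s < length P" "P ! fst_of s = Feedback_Query i j q q'"
  shows "sim_step X (st p s) y \<longleftrightarrow>
    (\<exists>r. (if mode \<noteq> 0 \<and> p = 0 then
        ((w, arg w 1 (1 - b) \<delta> (pair (value_of m (snd_of s) i) (value_of m (snd_of s) j)), X), r) \<in> I_infty \<and>
          y = (if r = Div then 0 else st 1 s)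
      else ((w, arg w 0 b (pair (value_of m (snd_of s) i) (value_of m (snd_of s) j)) 0, X), r) \<in> I_infty \<and>
          y = st 0 (pair (if r = Div then q' else q) (snd_of s))))"
proof -
  have rest: "rest_of (st p s) \<noteq> 0" using assms(1) sim_length[of p s] by auto
  have op: "op_of (st p s) \<noteq> 0" "op_of (st p s) \<noteq> 1"
    using sim_instr[OF assms(1), of p] assms(2) by (auto split: if_splits)
  then have eqs: "i = tape_of (st p s)" "j = fst_of (operand_of (st p s))"
      "q = fst_of (snd_of (operand_of (st p s)))" "q' = snd_of (snd_of (operand_of (st p s)))"
    using sim_instr[OF assms(1), of p] assms(2) by auto
  have q: "querying (st p s)" using rest op unfolding querying_def by auto
  show ?thesis
    using rest op q
    by (auto simp: driver_step_def query_index_def query_input_def queried_def comparing_def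
        next_state_def eqs set_machine_def simp del: accessors_sim_state(11))
qed

text \<open>A machine step takes one driver iteration, except that a feedback query in mode 1 takes
  two: the comparison and then the query.\<close>

lemma sim_step_correct:
  assumes "step D P Z (sim_config m s) c'"
  shows "\<exists>s'. sim_config m s' = c' \<and> (sim_step X)\<^sup>+\<^sup>+ (st 0 s) (st 0 s')"
  using assms
proof (cases rule: step.cases)
  case (act i \<Delta> v d q)
  then have *: "rest_of (st 0 s) \<noteq> 0" "fst_of s < length P" using sim_length[of 0 s] by auto
  have op: "op_of (st 0 s) = 0" using sim_instr[OF *(2), of 0] act(3) by (auto split: if_splits)
  then have eqs: "tape_of (st 0 s) = i" using sim_instr[OF *(2), of 0] act(3) by auto
  have entry: "entry_of (st 0 s) \<noteq> 0"
      "v = fst_of (snd_of (hd_of (entry_of (st 0 s))))"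
      "d = decode_move (fst_of (snd_of (snd_of (hd_of (entry_of (st 0 s))))))"
      "q = snd_of (snd_of (snd_of (hd_of (entry_of (st 0 s)))))"
    using sim_transition[of 0 s] sim_instr[OF *(2), of 0] act(3,4) op
    by (auto split: if_splits simp del: decode_move.simps)
  have "\<not> querying (st 0 s)" using op unfolding querying_def by auto
  moreover have "next_state (st 0 s) y z = st 0 (pair q (write_move i v
      (fst_of (snd_of (snd_of (hd_of (entry_of (st 0 s)))))) (snd_of s)))" for y z
    unfolding next_state_def using * op entry eqs
    by (simp add: set_machine_def del: accessors_sim_state(11))
  ultimately have "sim_step X (st 0 s) (st 0 (pair q (write_move i v
      (fst_of (snd_of (snd_of (hd_of (entry_of (st 0 s)))))) (snd_of s))))"
    using idle_step[of "st 0 s" X] by simp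
  moreover have "sim_config m (pair q (write_move i v
      (fst_of (snd_of (snd_of (hd_of (entry_of (st 0 s)))))) (snd_of s))) = c'"
    unfolding sim_config_write_move using act(1) entry(3) by simp
  ultimately show ?thesis by blast
next
  case (oracle_query i q q')
  then have *: "rest_of (st 0 s) \<noteq> 0" "fst_of s < length P" using sim_length[of 0 s] by auto
  have op: "op_of (st 0 s) = 1" using sim_instr[OF *(2), of 0] oracle_query(3) by (auto split: if_splits)
  then have eqs: "tape_of (st 0 s) = i" "fst_of (operand_of (st 0 s)) = q" "snd_of (operand_of (st 0 s)) = q'"
    using sim_instr[OF *(2), of 0] oracle_query(3) by auto
  have "\<not> querying (st 0 s)" using op unfolding querying_def by auto
  moreover have "next_state (st 0 s) (of_bool (X (oracle_question (st 0 s)))) z =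
      st 0 (pair (if Z (value_of m (snd_of s) i) then q else q') (snd_of s))" for z
    unfolding next_state_def using * op eqs
    by (simp add: set_machine_def oracle_question_def half_def del: accessors_sim_state(11))
  ultimately have "sim_step X (st 0 s) (st 0 (pair (if Z (value_of m (snd_of s) i) then q else q') (snd_of s)))"
    using idle_step[of "st 0 s" X] by simp
  moreover have "sim_config m (pair (if Z (value_of m (snd_of s) i) then q else q') (snd_of s)) = c'"
    using oracle_query(1) by (simp add: sim_config_state)
  ultimately show ?thesis by blast
next
  case (query_conv i j q q' k)
  then have s: "fst_of s < length P" "P ! fst_of s = Feedback_Query i j q q'" by auto
  let ?t = "pair (value_of m (snd_of s) i) (value_of m (snd_of s) j)"
  have in_D: "((value_of m (snd_of s) i, value_of m (snd_of s) j, Z), Conv k) \<in> D"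
    using query_conv(4) by simp
  from answered[OF this] obtain k' where k': "((w, arg w 0 b ?t 0, X), Conv k') \<in> I_infty"
    by (metis outcome.exhaust outcome.distinct(1))
  have final: "sim_step X (st p s) (st 0 (pair q (snd_of s)))" if "mode = 0 \<or> p \<noteq> 0" for p
    unfolding sim_step_query[OF s] using k' that by (intro exI[of _ "Conv k'"]) auto
  have "(sim_step X)\<^sup>+\<^sup>+ (st 0 s) (st 0 (pair q (snd_of s)))"
  proof (cases "mode = 0")
    case False
    from compared[OF False in_D] have "sim_step X (st 0 s) (st 1 s)"
      unfolding sim_step_query[OF s] using False by auto
    then show ?thesis
      by (rule tranclp.trancl_into_trancl[OF tranclp.r_into_trancl]) (rule final, simp)
  qed (use final in blast)
  moreover have "sim_config m (pair q (snd_of s)) = c'" using query_conv(1) by (simp add: sim_config_state)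
  ultimately show ?thesis by blast
next
  case (query_div i j q q')
  then have s: "fst_of s < length P" "P ! fst_of s = Feedback_Query i j q q'" by auto
  let ?t = "pair (value_of m (snd_of s) i) (value_of m (snd_of s) j)"
  have in_D: "((value_of m (snd_of s) i, value_of m (snd_of s) j, Z), Div) \<in> D"
    using query_div(4) by simp
  from answered[OF this] have div: "((w, arg w 0 b ?t 0, X), Div) \<in> I_infty" by auto
  have final: "sim_step X (st p s) (st 0 (pair q' (snd_of s)))" if "mode = 0 \<or> p \<noteq> 0" for p
    unfolding sim_step_query[OF s] using div that by (intro exI[of _ Div]) auto
  have "(sim_step X)\<^sup>+\<^sup>+ (st 0 s) (st 0 (pair q' (snd_of s)))"
  proof (cases "mode = 0")
    case False
    from compared[OF False in_D] have "sim_step X (st 0 s) (st 1 s)"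
      unfolding sim_step_query[OF s] using False by auto
    then show ?thesis
      by (rule tranclp.trancl_into_trancl[OF tranclp.r_into_trancl]) (rule final, simp)
  qed (use final in blast)
  moreover have "sim_config m (pair q' (snd_of s)) = c'" using query_div(1) by (simp add: sim_config_state)
  ultimately show ?thesis by blast
qed

lemma sim_run:
  assumes "(step D P Z)\<^sup>*\<^sup>* (initial_config m) c"
  shows "\<exists>s. sim_config m s = c \<and> (sim_step X)\<^sup>*\<^sup>* (start (arg w mode b (pair e m) \<delta>)) (st 0 s)"
  using assms
proof (induction rule: rtranclp_induct)
  case base
  then show ?case using sim_config_initial unfolding start_def by blast
next
  case (step c c')
  then show ?case using sim_step_correct by (metis rtranclp_trans tranclp_into_rtranclp)
qed

lemma simulate_infinite:
  assumes "f 0 = initial_config m" "\<And>n. step D P Z (f n) (f (Suc n))"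
  shows "((w, arg w mode b (pair e m) \<delta>, X), Div) \<in> I_infty"
proof -
  let ?S = "{st 0 s | s. \<exists>n. sim_config m s = f n}"
  have "start (arg w mode b (pair e m) \<delta>) \<in> ?S"
    unfolding start_def using assms(1) sim_config_initial
    by (intro CollectI exI[of _ "pair 0 0"] exI[of _ "0 :: nat"] conjI) auto
  moreover have "\<exists>y\<in>?S. (sim_step X)\<^sup>+\<^sup>+ x y" if "x \<in> ?S" for x
  proof -
    from that obtain s n where "x = st 0 s" "sim_config m s = f n" by blast
    then show ?thesis using sim_step_correct[of s "f (Suc n)"] assms(2)[of n] by auto
  qed
  ultimately show ?thesis by (rule simulator_diverges[OF simulator])
qed

lemma simulate_halted:
  assumes "(step D P Z)\<^sup>*\<^sup>* (initial_config m) c" "halted P c"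
  shows "((w, arg w mode b (pair e m) \<delta>, X), if mode = 0 then Conv 0 else Div) \<in> I_infty"
proof -
  from sim_run[OF assms(1)] obtain s where s: "sim_config m s = c"
    "(sim_step X)\<^sup>*\<^sup>* (start (arg w mode b (pair e m) \<delta>)) (st 0 s)" by blast
  have last: "sim_step X (st 0 s) (if mode = 0 then 0 else st 0 s)"
    using sim_step_halted s(1) assms(2) by blast
  show ?thesis
  proof (cases "mode = 0")
    case True
    then have "(sim_step X)\<^sup>*\<^sup>* (start (arg w mode b (pair e m) \<delta>)) 0" using s(2) last by auto
    then show ?thesis using True simulator unfolding simulator_def by auto
  next
    case False
    \<comment> \<open>In mode 1 the driver state of a halted machine steps to itself, so every state
      leading there starts an infinite run.\<close>
    let ?S = "{x. (sim_step X)\<^sup>*\<^sup>* x (st 0 s)}"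
    have "\<exists>y\<in>?S. (sim_step X)\<^sup>+\<^sup>+ x y" if "x \<in> ?S" for x
      using that last False by (intro bexI[of _ "st 0 s"]) (auto intro: rtranclp_into_tranclp1)
    with s(2) have "((w, arg w mode b (pair e m) \<delta>, X), Div) \<in> I_infty"
      by (intro simulator_diverges[OF simulator, of _ ?S]) auto
    then show ?thesis using False by simp
  qed
qed

text \<open>A run that is stuck without having halted waits for a query outside the domain of
  \<open>D\<close>. The comparison asked first then diverges, and the driver stops before making
  that query.\<close>

lemma simulate_stuck:
  assumes "mode \<noteq> 0" "(step D P Z)\<^sup>*\<^sup>* (initial_config m) c" "\<not> halted P c" "\<nexists>c'. step D P Z c c'"
    and undefined_query: "\<And>e' m'. (e', m', Z) \<notin> Domain D \<Longrightarrow>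
      ((w, arg w 1 (1 - b) \<delta> (pair e' m'), X), Div) \<in> I_infty"
  shows "((w, arg w mode b (pair e m) \<delta>, X), Conv 0) \<in> I_infty"
proof -
  from sim_run[OF assms(2)] obtain s where s: "sim_config m s = c"
    "(sim_step X)\<^sup>*\<^sup>* (start (arg w mode b (pair e m) \<delta>)) (st 0 s)" by blast
  have len: "state c < length P" using assms(3) by (auto simp: halted_def)
  obtain i j q q' where instr: "P ! state c = Feedback_Query i j q q'"
  proof (cases "P ! state c")
    case (Act i \<Delta>)
    then have "map_of \<Delta> (scanned c i) \<noteq> None" using assms(3) by (auto simp: halted_def)
    then show ?thesis using step.act[OF len Act] assms(4) by fastforce
  next
    case (Oracle_Query i q q')
    then show ?thesis using step.oracle_query[OF len Oracle_Query] assms(4) by blast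
  qed
  have "(value_of m (snd_of s) i, value_of m (snd_of s) j, Z) \<notin> Domain D"
  proof
    assume "(value_of m (snd_of s) i, value_of m (snd_of s) j, Z) \<in> Domain D"
    then obtain r where r: "((tape_value c i, tape_value c j, Z), r) \<in> D" using s(1) by auto
    then show False
      using step.query_conv[OF len instr, of Z] step.query_div[OF len instr, of Z] assms(4)
      by (cases r) blast+
  qed
  from undefined_query[OF this] have "sim_step X (st 0 s) 0"
    using len instr s(1) assms(1) by (subst sim_step_query) auto
  with s(2) have "(sim_step X)\<^sup>*\<^sup>* (start (arg w mode b (pair e m) \<delta>)) 0" by auto
  then show ?thesis using simulator unfolding simulator_def by auto
qed

end

section \<open>Comparison of ranks\<close>

text \<open>If no reachable configuration is halted or stuck, the run can be prolonged for ever and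
  has the result \<open>Div\<close>.\<close>

lemma I_op_or_stuck:
  "(e, m, X) \<in> Domain (I_op D) \<or>
    (\<exists>c. (step D (program_of e) X)\<^sup>*\<^sup>* (initial_config m) c \<and> \<not> halted (program_of e) c \<and>
      (\<nexists>c'. step D (program_of e) X c c'))"
proof (rule ccontr)
  let ?r = "step D (program_of e) X"
  let ?S = "{c. ?r\<^sup>*\<^sup>* (initial_config m) c}"
  assume "\<not> ?thesis"
  then have dom: "(e, m, X) \<notin> Domain (I_op D)"
    and next_ex: "\<And>c. c \<in> ?S \<Longrightarrow> halted (program_of e) c \<or> (\<exists>c'. ?r c c')" by auto
  have "\<exists>c'\<in>?S. ?r\<^sup>+\<^sup>+ c c'" if c: "c \<in> ?S" for c
  proof -
    have "\<not> halted (program_of e) c" using c dom I_op_converges[of D e X m c] by blast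
    then obtain c' where "?r c c'" using next_ex[OF c] by blast
    moreover have "c' \<in> ?S" using c \<open>?r c c'\<close> by (auto intro: rtranclp.rtrancl_into_rtrancl)
    ultimately show ?thesis by blast
  qed
  with infinite_run[of "initial_config m" ?S ?r] obtain f
    where "f 0 = initial_config m" "\<And>n. ?r (f n) (f (Suc n))" by auto
  then show False using dom I_op_diverges[of f m D e X] by blast
qed

text \<open>By induction on the stage, since queries are answered at earlier stages. The simulation
  returns 0 in place of the true output, but an asking machine only sees whether a query
  converges.\<close>

lemma simulation:
  assumes w: "simulator w" and "((e, m, half X b), r) \<in> I_infty"
  shows "\<exists>r'. ((w, arg w 0 b (pair e m) 0, X), r') \<in> I_infty \<and> (r' = Div \<longleftrightarrow> r = Div)"
proof -
  from assms(2) obtain \<alpha> where "((e, m, half X b), r) \<in> I_stage \<alpha>"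
    unfolding I_infty_eq_Union_I_stage by blast
  then show ?thesis
  proof (induction \<alpha> arbitrary: e m r rule: less_induct)
    case (less \<alpha>)
    let ?D = "\<Union>\<beta>\<in>{\<beta>. \<beta> < \<alpha>}. I_stage \<beta>"
    have ans: "\<exists>r'. ((w, arg w 0 b (pair e' m') 0, X), r') \<in> I_infty \<and> (r' = Div \<longleftrightarrow> r = Div)"
      if "((e', m', half X b), r) \<in> ?D" for e' m' r
      using that less.IH by blast
    from less.prems have "((e, m, half X b), r) \<in> I_op ?D" unfolding I_stage.simps[of \<alpha>] .
    then show ?case
    proof (cases rule: I_op_cases)
      case (converges c)
      from simulate_halted[where mode=0 and \<delta>=0, OF w ans _ converges(2,3)] converges(1)
      show ?thesis by auto
    next
      case (diverges f)
      from simulate_infinite[where mode=0 and \<delta>=0, OF w ans _ diverges(2,3)] diverges(1)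
      show ?thesis by auto
    qed
  qed
qed

section \<open>Stages and ranks\<close>

definition I_below :: "countable_ordinal \<Rightarrow> (comp \<times> outcome) set" where
  "I_below \<alpha> = (\<Union>\<beta>\<in>{\<beta>. \<beta> < \<alpha>}. I_stage \<beta>)"

lemma I_stage_eq: "I_stage \<alpha> = I_op (I_below \<alpha>)"
  unfolding I_below_def by (rule I_stage.simps)

lemma I_below_subset: "I_below \<alpha> \<subseteq> I_infty"
  unfolding I_below_def I_infty_eq_Union_I_stage by blast

lemma less_CountableE:
  assumes "x < Countable \<alpha>"
  obtains \<beta> where "\<beta> < \<alpha>" "x = Countable \<beta>"
  using assms by (cases x) (auto simp: less_ordinal_le_omega1_def less_le_not_le)

text \<open>Holds because stages increase. Together with \<open>rank_less_iff\<close> it expresses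
  thresholds by membership, also for \<gamma> without a countable rank.\<close>

lemma rank_le_iff: "\<rho> \<gamma> \<le> Countable \<alpha> \<longleftrightarrow> \<gamma> \<in> Domain (I_stage \<alpha>)"
proof
  let ?Q = "\<lambda>\<alpha>. \<exists>r. (\<gamma>, r) \<in> I_stage \<alpha>"
  assume "\<rho> \<gamma> \<le> Countable \<alpha>"
  then have ex: "\<exists>\<alpha>. ?Q \<alpha>" and le: "(LEAST \<alpha>. ?Q \<alpha>) \<le> \<alpha>"
    unfolding rank_def by (auto split: if_splits)
  from LeastI_ex[OF ex] I_stage_subset[OF le] show "\<gamma> \<in> Domain (I_stage \<alpha>)" by blast
next
  let ?Q = "\<lambda>\<alpha>. \<exists>r. (\<gamma>, r) \<in> I_stage \<alpha>"
  assume "\<gamma> \<in> Domain (I_stage \<alpha>)"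
  then have "?Q \<alpha>" by blast
  moreover from this have "(LEAST \<alpha>. ?Q \<alpha>) \<le> \<alpha>" by (rule Least_le)
  ultimately show "\<rho> \<gamma> \<le> Countable \<alpha>" unfolding rank_def by auto
qed

lemma rank_less_iff: "\<rho> \<gamma> < Countable \<alpha> \<longleftrightarrow> \<gamma> \<in> Domain (I_below \<alpha>)"
proof
  assume "\<rho> \<gamma> < Countable \<alpha>"
  then obtain \<beta> where "\<beta> < \<alpha>" "\<rho> \<gamma> = Countable \<beta>" by (rule less_CountableE)
  then show "\<gamma> \<in> Domain (I_below \<alpha>)"
    using rank_le_iff[of \<gamma> \<beta>] unfolding I_below_def by auto
next
  assume "\<gamma> \<in> Domain (I_below \<alpha>)"
  then obtain \<beta> where "\<beta> < \<alpha>" "\<gamma> \<in> Domain (I_stage \<beta>)" unfolding I_below_def by blast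
  then have "\<rho> \<gamma> \<le> Countable \<beta>" "Countable \<beta> < Countable \<alpha>"
    using rank_le_iff by (auto simp: less_ordinal_le_omega1_def)
  then show "\<rho> \<gamma> < Countable \<alpha>" by (rule le_less_trans)
qed

text \<open>A computation defined at stage \<alpha> finds its queries answered in
  \<open>I_below \<alpha>\<close>, and all of them pass the comparison. So it is simulated for ever,
  or until it halts and the driver loops.\<close>

lemma comparison_diverges:
  assumes w: "simulator w" and "\<rho> (e, m, half X b) \<le> Countable \<alpha>"
    and smaller: "\<And>e' m'. \<rho> (e', m', half X b) < Countable \<alpha> \<Longrightarrow>
      ((w, arg w 1 (1 - b) \<delta> (pair e' m'), X), Conv 0) \<in> I_infty"
  shows "((w, arg w 1 b (pair e m) \<delta>, X), Div) \<in> I_infty"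
proof -
  have ans: "\<exists>r'. ((w, arg w 0 b (pair e' m') 0, X), r') \<in> I_infty \<and> (r' = Div \<longleftrightarrow> r = Div)"
    if "((e', m', half X b), r) \<in> I_below \<alpha>" for e' m' r
    using simulation[OF w] that I_below_subset by blast
  have cmp: "\<exists>k. ((w, arg w 1 (1 - b) \<delta> (pair e' m'), X), Conv k) \<in> I_infty"
    if "((e', m', half X b), r) \<in> I_below \<alpha>" for e' m' r
    using that smaller rank_less_iff by blast
  from assms(2) obtain r where "((e, m, half X b), r) \<in> I_op (I_below \<alpha>)"
    unfolding rank_le_iff I_stage_eq by blast
  then show ?thesis
  proof (cases rule: I_op_cases)
    case (converges c)
    from simulate_halted[where mode=1, OF w ans cmp converges(2,3)] show ?thesis by simp
  next
    case (diverges f)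
    from simulate_infinite[where mode=1, OF w ans cmp diverges(2,3)] show ?thesis .
  qed
qed

text \<open>Relative to \<open>I_below \<alpha>\<close> the run gets stuck, or else it would have a
  result at stage \<alpha>. The query where it is stuck does not have rank below \<alpha>, so its
  comparison diverges and the program halts.\<close>

lemma comparison_converges:
  assumes w: "simulator w" and "\<not> \<rho> (e, m, half X b) \<le> Countable \<alpha>"
    and smaller: "\<And>e' m'. \<rho> (e', m', half X b) < Countable \<alpha> \<Longrightarrow>
      ((w, arg w 1 (1 - b) \<delta> (pair e' m'), X), Conv 0) \<in> I_infty"
    and larger: "\<And>e' m'. \<not> \<rho> (e', m', half X b) < Countable \<alpha> \<Longrightarrow>
      ((w, arg w 1 (1 - b) \<delta> (pair e' m'), X), Div) \<in> I_infty"
  shows "((w, arg w 1 b (pair e m) \<delta>, X), Conv 0) \<in> I_infty"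
proof -
  have ans: "\<exists>r'. ((w, arg w 0 b (pair e' m') 0, X), r') \<in> I_infty \<and> (r' = Div \<longleftrightarrow> r = Div)"
    if "((e', m', half X b), r) \<in> I_below \<alpha>" for e' m' r
    using simulation[OF w] that I_below_subset by blast
  have cmp: "\<exists>k. ((w, arg w 1 (1 - b) \<delta> (pair e' m'), X), Conv k) \<in> I_infty"
    if "((e', m', half X b), r) \<in> I_below \<alpha>" for e' m' r
    using that smaller rank_less_iff by blast
  from assms(2) obtain c where
    "(step (I_below \<alpha>) (program_of e) (half X b))\<^sup>*\<^sup>* (initial_config m) c"
    "\<not> halted (program_of e) c" "\<nexists>c'. step (I_below \<alpha>) (program_of e) (half X b) c c'"
    using I_op_or_stuck unfolding rank_le_iff I_stage_eq by blast
  from simulate_stuck[where mode=1, OF w ans cmp _ this] larger[unfolded rank_less_iff]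
  show ?thesis by auto
qed

definition compares :: "nat \<Rightarrow> oracle_set \<Rightarrow> nat \<Rightarrow> nat \<Rightarrow> nat \<Rightarrow> nat \<Rightarrow> nat \<Rightarrow> bool" where
  "compares w X b e m e' m' \<longleftrightarrow>
    ((w, arg w 1 b (pair e m) (pair e' m'), X),
      if \<rho> (e', m', half X (1 - b)) < \<rho> (e, m, half X b) then Conv 0 else Div) \<in> I_infty"

text \<open>The two conjuncts must be proved together: each comparison asks for others with
  exchanged roles. Only one of the two computations is assumed to have a countable rank.\<close>

lemma compares_both:
  assumes w: "simulator w"
  shows "b \<le> 1 \<Longrightarrow> \<rho> (e, m, half X b) = Countable \<alpha> \<Longrightarrow>
    compares w X b e m e' m' \<and> compares w X (1 - b) e' m' e m"
proof (induction \<alpha> arbitrary: b e m e' m' rule: less_induct)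
  case (less \<alpha>)
  have bb: "1 - (1 - b) = b" "1 - b \<le> 1" using less.prems(1) by auto
  have first: "compares w X b e m e' m'" for e' m'
  proof (cases "\<rho> (e', m', half X (1 - b)) < \<rho> (e, m, half X b)")
    case True
    then obtain \<beta> where "\<beta> < \<alpha>" "\<rho> (e', m', half X (1 - b)) = Countable \<beta>"
      unfolding less.prems(2) by (rule less_CountableE)
    \<comment> \<open>Here the rival has the smaller rank, and the second conjunct of the induction
      hypothesis for it is the claim.\<close>
    from less.IH[OF this(1) bb(2) this(2)] show ?thesis unfolding bb by blast
  next
    case False
    have "((w, arg w 1 (1 - b) (pair e' m') (pair e'' m''), X), Conv 0) \<in> I_infty"
      if "\<rho> (e'', m'', half X b) < Countable \<alpha>" for e'' m''
    proof -
      from that obtain \<beta> where "\<beta> < \<alpha>" "\<rho> (e'', m'', half X b) = Countable \<beta>"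
        by (rule less_CountableE)
      \<comment> \<open>The query \<open>(e'', m'')\<close> has rank below \<alpha>, so the
        induction hypothesis applies to it whatever the rank of the rival.\<close>
      from less.IH[OF this(1) less.prems(1) this(2)] have "compares w X (1 - b) e' m' e'' m''" by blast
      moreover have "\<rho> (e'', m'', half X b) < \<rho> (e', m', half X (1 - b))"
        using that False less.prems(2) by (metis less_le_trans not_less)
      ultimately show ?thesis unfolding compares_def bb by simp
    qed
    then have "((w, arg w 1 b (pair e m) (pair e' m'), X), Div) \<in> I_infty"
      using less.prems(2) by (intro comparison_diverges[OF w, where \<alpha>=\<alpha>]) simp_all
    with False show ?thesis unfolding compares_def by simp
  qed
  \<comment> \<open>Queries of \<open>(e', m')\<close> may have any rank; \<open>first\<close>
    settles how \<open>(e, m)\<close> compares with each of them.\<close>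
  have "compares w X (1 - b) e' m' e m"
  proof (cases "\<rho> (e, m, half X b) < \<rho> (e', m', half X (1 - b))")
    case True
    have "((w, arg w 1 (1 - b) (pair e' m') (pair e m), X), Conv 0) \<in> I_infty"
    proof (rule comparison_converges[OF w, where \<alpha>=\<alpha>])
      show "\<not> \<rho> (e', m', half X (1 - b)) \<le> Countable \<alpha>" using True less.prems(2) by (simp add: not_le)
      fix e'' m''
      show "((w, arg w 1 (1 - (1 - b)) (pair e m) (pair e'' m''), X), Conv 0) \<in> I_infty"
        if "\<rho> (e'', m'', half X (1 - b)) < Countable \<alpha>"
        using first[of e'' m''] that less.prems(2) unfolding compares_def bb by simp
      show "((w, arg w 1 (1 - (1 - b)) (pair e m) (pair e'' m''), X), Div) \<in> I_infty"
        if "\<not> \<rho> (e'', m'', half X (1 - b)) < Countable \<alpha>"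
        using first[of e'' m''] that less.prems(2) unfolding compares_def bb by simp
    qed
    then show ?thesis using True unfolding compares_def bb by simp
  next
    case False
    have "((w, arg w 1 (1 - b) (pair e' m') (pair e m), X), Div) \<in> I_infty"
    proof (rule comparison_diverges[OF w, where \<alpha>=\<alpha>])
      show "\<rho> (e', m', half X (1 - b)) \<le> Countable \<alpha>" using False less.prems(2) by (simp add: not_less)
      fix e'' m'' assume "\<rho> (e'', m'', half X (1 - b)) < Countable \<alpha>"
      then show "((w, arg w 1 (1 - (1 - b)) (pair e m) (pair e'' m''), X), Conv 0) \<in> I_infty"
        using first[of e'' m''] less.prems(2) unfolding compares_def bb by simp
    qed
    then show ?thesis using False unfolding compares_def bb by simp
  qed
  with first show ?case by blast
qed

lemma compares_if_ranked:
  assumes "simulator w" "\<rho> (e, m, half X 0) < \<omega>\<^sub>1 \<or> \<rho> (e', m', half X 1) < \<omega>\<^sub>1"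
  shows "compares w X 0 e m e' m'"
proof -
  from assms(2) consider \<alpha> where "\<rho> (e, m, half X 0) = Countable \<alpha>" | \<alpha> where "\<rho> (e', m', half X 1) = Countable \<alpha>"
    by (metis less_irrefl ordinal_le_omega1.exhaust)
  then show ?thesis
  proof cases
    case 1
    from compares_both[OF assms(1) _ this] show ?thesis by auto
  next
    case 2
    from compares_both[OF assms(1) _ this, of e m] show ?thesis by auto
  qed
qed

section \<open>The comparison function\<close>

lemma half_join: "half (X \<oplus> Y) 0 = X" "half (X \<oplus> Y) 1 = Y"
  by (auto simp: half_def join_def fun_eq_iff simp flip: mult_2)

text \<open>A driver with a single round: it queries \<open>w\<close> and outputs the answer bit,
  which is below 2 and so ends the loop. Thus convergence and divergence become the outputs 1 and
  0.\<close>

lemma comparison_program: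
  fixes w :: nat
  obtains g where "\<And>X e0 m0 e1 m1 r. ((w, arg w 1 0 (pair e0 m0) (pair e1 m1), X), r) \<in> I_infty \<Longrightarrow>
    feedback_conv g X (list_encode [e0, m0, e1, m1]) (of_bool (r \<noteq> Div))"
proof -
  \<comment> \<open>The subtraction undoes \<open>start\<close>, which shifts the input by 2 so that
    the round takes place.\<close>
  define inp where "inp x = arg w 1 0 (pair (hd_of (x - 2)) (hd_of (tl_of (x - 2))))
    (pair (hd_of (tl_of (tl_of (x - 2)))) (hd_of (tl_of (tl_of (tl_of (x - 2))))))" for x
  define start where "start m = Suc (Suc m)" for m
  have comp: "computable inp" "computable start" "computable (\<lambda>x. 0)" "computable (\<lambda>x. w)"
    "computable (\<lambda>z. snd_of (snd_of z))"
    unfolding inp_def arg_def start_def by (intro computable_intros)+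
  obtain g where g: "\<And>X m x. (driver_step (\<lambda>x. 0) (\<lambda>x. w) inp (\<lambda>x b b'. b') X)\<^sup>*\<^sup>* (start m) x \<Longrightarrow>
      x < 2 \<Longrightarrow> ((g, m, X), Conv x) \<in> I_infty"
    by (rule driver_program[where upd="\<lambda>x b b'. b'", OF comp(2-4,1,5)]) blast
  show thesis
  proof (rule that)
    fix X e0 m0 e1 m1 r
    let ?m = "list_encode [e0, m0, e1, m1]"
    assume "((w, arg w 1 0 (pair e0 m0) (pair e1 m1), X), r) \<in> I_infty"
    moreover have "inp (start ?m) = arg w 1 0 (pair e0 m0) (pair e1 m1)"
      by (simp add: inp_def start_def flip: pair_def)
    ultimately have "driver_step (\<lambda>x. 0) (\<lambda>x. w) inp (\<lambda>x b b'. b') X (start ?m) (of_bool (r \<noteq> Div))"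
      unfolding driver_step_def by (auto simp: start_def)
    then show "feedback_conv g X ?m (of_bool (r \<noteq> Div))"
      unfolding feedback_conv_def by (intro g r_into_rtranclp) auto
  qed
qed

theorem theorem2p26:
  "\<exists>G. partial_feedback_computable G \<and>
    (\<forall>X Y e0 m0 e1 m1.
      let \<gamma> = (e0, m0, X); \<delta> = (e1, m1, Y) in
        (\<rho> \<gamma> < \<omega>\<^sub>1 \<and> \<rho> \<gamma> \<le> \<rho> \<delta> \<longrightarrow> G \<gamma> \<delta> = Some 0) \<and>
        (\<rho> \<delta> < \<omega>\<^sub>1 \<and> \<rho> \<delta> < \<rho> \<gamma> \<longrightarrow> G \<gamma> \<delta> = Some 1))"
proof -
  obtain w where w: "simulator w" using simulator_exists by blast
  obtain g where g: "\<And>X e0 m0 e1 m1 r. ((w, arg w 1 0 (pair e0 m0) (pair e1 m1), X), r) \<in> I_infty \<Longrightarrow>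
    feedback_conv g X (list_encode [e0, m0, e1, m1]) (of_bool (r \<noteq> Div))"
    using comparison_program[of w] by blast
  define conv where "conv = (\<lambda>(e0, m0, X) (e1, m1, Y) i.
    feedback_conv g (X \<oplus> Y) (list_encode [e0, m0, e1, m1]) i)"
  define G where "G \<gamma> \<delta> = (if \<exists>i. conv \<gamma> \<delta> i then Some (THE i. conv \<gamma> \<delta> i) else None)" for \<gamma> \<delta>
  have unique: "i = j" if "conv \<gamma> \<delta> i" "conv \<gamma> \<delta> j" for \<gamma> \<delta> i j
    using that single_valuedD[OF single_valued_I_infty]
    by (fastforce simp: conv_def feedback_conv_def split: prod.splits)
  have "(THE i. conv \<gamma> \<delta> i) = i" if "conv \<gamma> \<delta> i" for \<gamma> \<delta> i
    using that unique[OF _ that] by (rule the_equality)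
  then have G: "G \<gamma> \<delta> = Some i \<longleftrightarrow> conv \<gamma> \<delta> i" for \<gamma> \<delta> i
    unfolding G_def by (metis option.distinct(1) option.inject)
  have "partial_feedback_computable G"
    unfolding partial_feedback_computable_def G conv_def by auto
  moreover have "G (e0, m0, X) (e1, m1, Y) = Some (of_bool (\<rho> (e1, m1, Y) < \<rho> (e0, m0, X)))"
    if "\<rho> (e0, m0, X) < \<omega>\<^sub>1 \<or> \<rho> (e1, m1, Y) < \<omega>\<^sub>1" for X Y e0 m0 e1 m1
  proof -
    have "compares w (X \<oplus> Y) 0 e0 m0 e1 m1"
      using that w by (intro compares_if_ranked) (simp_all only: half_join)
    \<comment> \<open>The output is 1 exactly if the comparison converges, that is, if the second
      computation has the smaller rank.\<close>
    from g[OF this[unfolded compares_def]] show ?thesis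
      unfolding G conv_def by (auto simp: half_join half_join[unfolded One_nat_def] split: if_splits)
  qed
  ultimately show ?thesis
    by (intro exI[of _ G]) (auto simp: Let_def leD)
qed

end
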